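(* Let $\mathcal B$ and $\mathcal B'$ be relative Rota-Baxter operators on a Lie group $G$ with respect to an action $(H;\Phi)$, and let $(\Psi_G,\Psi_H)$ be a homomorphism from $\mathcal B'$ to $\mathcal B$. Then $((\Psi_G)_{*e_G},(\Psi_H)_{*e_H})$ is a homomorphism from the relative Rota-Baxter operator $\mathcal B'_{*e_H}$ to the relative Rota-Baxter operator $\mathcal B_{*e_H}$ (both on the Lie algebra $\mathfrak g$ of $G$ with respect to $(\mathfrak h;\phi)$, where $\mathfrak h$ is the Lie algebra of $H$ and $\phi$ is the differentiated action of $\Phi$).
   Context: Lie groups are real and finite-dimensional. An action of $G$ on $H$ is a group homomorphism $\Phi:G\to\mathrm{Aut}(H)$ into the Lie group automorphisms of $H$ such that $(g,h)\mapsto\Phi(g)h$ is smooth. A relative Rota-Baxter operator on $G$ with respect to $(H;\Phi)$ is a smooth map $\mathcal B:H\to G$ with $\mathcal B(h_1)\cdot_G\mathcal B(h_2)=\mathcal B(h_1\cdot_H\Phi(\mathcal B(h_1))h_2)$. A homomorphism from $\mathcal B'$ to $\mathcal B$ is a pair of Lie group homomorphisms $\Psi_G:G\to G$, $\Psi_H:H\to H$ with $\mathcal B\circ\Psi_H=\Psi_G\circ\mathcal B'$ and $\Psi_H(\Phi(g)h)=\Phi(\Psi_G(g))\Psi_H(h)$ for all $g\in G,h\in H$. Differentiated action: $\tilde\Phi(g)=\Phi(g)_{*e_H}\in\mathrm{Aut}(\mathfrak h)$, $\phi:=\tilde\Phi_{*e_G}:\mathfrak g\to\mathrm{Der}(\mathfrak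 h)$. A relative Rota-Baxter operator (of weight $1$) on $\mathfrak g$ with respect to $(\mathfrak h;\phi)$ is a linear map $B:\mathfrak h\to\mathfrak g$ with $[B(u),B(v)]_{\mathfrak g}=B(\phi(B(u))v-\phi(B(v))u+[u,v]_{\mathfrak h})$; for a relative Rota-Baxter operator $\mathcal B$ on $G$, the tangent map $\mathcal B_{*e_H}$ is one. A homomorphism from $B'$ to $B$ is a pair of Lie algebra homomorphisms $\psi_{\mathfrak g}:\mathfrak g\to\mathfrak g$, $\psi_{\mathfrak h}:\mathfrak h\to\mathfrak h$ with $\psi_{\mathfrak g}\circ B'=B\circ\psi_{\mathfrak h}$ and $\psi_{\mathfrak h}(\phi(x)v)=\phi(\psi_{\mathfrak g}(x))\psi_{\mathfrak h}(v)$ for all $x\in\mathfrak g,v\in\mathfrak h$. *)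

theory Defs
  imports "HOL-Analysis.Analysis" "HOL-Algebra.Group"
begin

section \<open>Smooth maps between open subsets of finite-dimensional spaces\<close>

text \<open>\<open>Ck_on k S f\<close> is only used for \<open>S\<close> open in a finite-dimensional space, where requiring
  all directional derivatives of \<open>f\<close> to be of class $C^{k}$ is the same as requiring the
  derivative of \<open>f\<close> to be of class $C^{k}$.\<close>

primrec Ck_on ::
  "nat \<Rightarrow> 'e::real_normed_vector set \<Rightarrow> ('e \<Rightarrow> 'f::real_normed_vector) \<Rightarrow> bool" where
  "Ck_on 0 S f \<longleftrightarrow> continuous_on S f"
| "Ck_on (Suc k) S f \<longleftrightarrow>
     (\<forall>x\<in>S. f differentiable (at x)) \<and>
     (\<forall>v. Ck_on k S (\<lambda>x. frechet_derivative f (at x) v))"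

definition smooth_on ::
  "'e::real_normed_vector set \<Rightarrow> ('e \<Rightarrow> 'f::real_normed_vector) \<Rightarrow> bool" where
  "smooth_on S f \<longleftrightarrow> (\<forall>k. Ck_on k S f)"


section \<open>Smooth manifolds\<close>

text \<open>The model space is a finite-dimensional real inner product space rather than a type of
  class \<open>euclidean_space\<close>, because the latter excludes dimension 0 (discrete Lie groups).
  The atlas need not be maximal. A chart is a pair of its domain and the coordinate map; the
  values of the coordinate map outside the domain are irrelevant.\<close>

type_synonym ('a, 'e) chart = "'a set \<times> ('a \<Rightarrow> 'e)"

record ('a, 'e) mfd =
  topo :: "'a topology"
  atlas :: "('a, 'e) chart set"

definition smooth_manifold :: "('a, 'e::real_inner) mfd \<Rightarrow> bool" where
  "smooth_manifold M \<longleftrightarrow>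
     (\<exists>B::'e set. finite B \<and> span B = UNIV) \<and>
     Hausdorff_space (topo M) \<and> second_countable (topo M) \<and>
     (\<Union>(U, x)\<in>atlas M. U) = topspace (topo M) \<and>
     (\<forall>(U, x)\<in>atlas M. openin (topo M) U \<and> open (x ` U) \<and>
        homeomorphic_map (subtopology (topo M) U) (top_of_set (x ` U)) x) \<and>
     (\<forall>(U, x)\<in>atlas M. \<forall>(V, y)\<in>atlas M. smooth_on (x ` (U \<inter> V)) (y \<circ> inv_into U x))"

definition smooth_map_on ::
  "('a, 'e::real_inner) mfd \<Rightarrow> ('b, 'f::real_inner) mfd \<Rightarrow> 'a set \<Rightarrow> ('a \<Rightarrow> 'b) \<Rightarrow> bool" where
  "smooth_map_on M N S F \<longleftrightarrow>
     openin (topo M) S \<and>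
     continuous_map (subtopology (topo M) S) (topo N) F \<and>
     (\<forall>(U, x)\<in>atlas M. \<forall>(V, y)\<in>atlas N.
        smooth_on (x ` {p \<in> U \<inter> S. F p \<in> V}) (y \<circ> F \<circ> inv_into U x))"

abbreviation smooth_map ::
  "('a, 'e::real_inner) mfd \<Rightarrow> ('b, 'f::real_inner) mfd \<Rightarrow> ('a \<Rightarrow> 'b) \<Rightarrow> bool" where
  "smooth_map M N F \<equiv> smooth_map_on M N (topspace (topo M)) F"

definition real_mfd :: "(real, real) mfd" where
  "real_mfd = \<lparr>topo = euclidean, atlas = {(UNIV, id)}\<rparr>"

definition prod_mfd ::
  "('a, 'e::real_inner) mfd \<Rightarrow> ('b, 'f::real_inner) mfd \<Rightarrow> ('a \<times> 'b, 'e \<times> 'f) mfd" where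
  "prod_mfd M N = \<lparr>topo = prod_topology (topo M) (topo N),
     atlas = {(U \<times> V, map_prod x y) | U x V y. (U, x) \<in> atlas M \<and> (V, y) \<in> atlas N}\<rparr>"


section \<open>Tangent vectors and tangent maps\<close>

text \<open>A tangent vector at \<open>p\<close> is the directional derivative $f \mapsto (f \circ \gamma)'(0)$ along a
  smooth curve \<open>\<gamma>\<close> with \<open>\<gamma> 0 = p\<close>, acting on the functions that are smooth near \<open>p\<close>. Functionals
  are set to 0 on all other functions, so that equality of tangent vectors is equality in HOL.\<close>

definition smooth_near :: "('a, 'e::real_inner) mfd \<Rightarrow> 'a \<Rightarrow> ('a \<Rightarrow> real) set" where
  "smooth_near M p = {f. \<exists>S. p \<in> S \<and> smooth_map_on M real_mfd S f}"

definition velocity ::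
  "('a, 'e::real_inner) mfd \<Rightarrow> (real \<Rightarrow> 'a) \<Rightarrow> ('a \<Rightarrow> real) \<Rightarrow> real" where
  "velocity M \<gamma> = (\<lambda>f. if f \<in> smooth_near M (\<gamma> 0) then deriv (f \<circ> \<gamma>) 0 else 0)"

definition tangent_space ::
  "('a, 'e::real_inner) mfd \<Rightarrow> 'a \<Rightarrow> (('a \<Rightarrow> real) \<Rightarrow> real) set" where
  "tangent_space M p =
     {velocity M \<gamma> | \<gamma> \<epsilon>. \<epsilon> > 0 \<and> smooth_map_on real_mfd M {-\<epsilon><..<\<epsilon>} \<gamma> \<and> \<gamma> 0 = p}"

definition tangent_map ::
  "('a, 'e::real_inner) mfd \<Rightarrow> ('b, 'f::real_inner) mfd \<Rightarrow> ('a \<Rightarrow> 'b) \<Rightarrow> 'a \<Rightarrow>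
   (('a \<Rightarrow> real) \<Rightarrow> real) \<Rightarrow> ('b \<Rightarrow> real) \<Rightarrow> real" where
  "tangent_map M N F p X = (\<lambda>f. if f \<in> smooth_near N (F p) then X (f \<circ> F) else 0)"

definition vf_bracket ::
  "('a, 'e::real_inner) mfd \<Rightarrow> ('a \<Rightarrow> ('a \<Rightarrow> real) \<Rightarrow> real) \<Rightarrow> ('a \<Rightarrow> ('a \<Rightarrow> real) \<Rightarrow> real) \<Rightarrow>
   'a \<Rightarrow> ('a \<Rightarrow> real) \<Rightarrow> real" where
  "vf_bracket M V W p =
     (\<lambda>f. if f \<in> smooth_near M p then V p (\<lambda>q. W q f) - W p (\<lambda>q. V q f) else 0)"


section \<open>Lie groups and actions\<close>

record ('a, 'e) lie_grp = "'a monoid" +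
  lmfd :: "('a, 'e) mfd"

definition lie_group :: "('a, 'e::real_inner) lie_grp \<Rightarrow> bool" where
  "lie_group G \<longleftrightarrow>
     group G \<and> smooth_manifold (lmfd G) \<and> topspace (topo (lmfd G)) = carrier G \<and>
     smooth_map (prod_mfd (lmfd G) (lmfd G)) (lmfd G) (\<lambda>(a, b). a \<otimes>\<^bsub>G\<^esub> b) \<and>
     smooth_map (lmfd G) (lmfd G) (\<lambda>a. inv\<^bsub>G\<^esub> a)"

definition lie_group_hom ::
  "('a, 'e::real_inner) lie_grp \<Rightarrow> ('b, 'f::real_inner) lie_grp \<Rightarrow> ('a \<Rightarrow> 'b) set" where
  "lie_group_hom G H = {\<Psi> \<in> hom G H. smooth_map (lmfd G) (lmfd H) \<Psi>}"

definition lie_group_aut :: "('a, 'e::real_inner) lie_grp \<Rightarrow> ('a \<Rightarrow> 'a) set" where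
  "lie_group_aut H = {\<Psi> \<in> lie_group_hom H H.
     bij_betw \<Psi> (carrier H) (carrier H) \<and> inv_into (carrier H) \<Psi> \<in> lie_group_hom H H}"

definition lie_action ::
  "('g, 'e::real_inner) lie_grp \<Rightarrow> ('h, 'f::real_inner) lie_grp \<Rightarrow> ('g \<Rightarrow> 'h \<Rightarrow> 'h) \<Rightarrow> bool" where
  "lie_action G H \<Phi> \<longleftrightarrow>
     (\<forall>g\<in>carrier G. \<Phi> g \<in> lie_group_aut H) \<and>
     (\<forall>g1\<in>carrier G. \<forall>g2\<in>carrier G. \<forall>h\<in>carrier H. \<Phi> (g1 \<otimes>\<^bsub>G\<^esub> g2) h = \<Phi> g1 (\<Phi> g2 h)) \<and>
     smooth_map (prod_mfd (lmfd G) (lmfd H)) (lmfd H) (\<lambda>(g, h). \<Phi> g h)"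


section \<open>Relative Rota-Baxter operators on Lie groups\<close>

definition rb_operator ::
  "('g, 'e::real_inner) lie_grp \<Rightarrow> ('h, 'f::real_inner) lie_grp \<Rightarrow> ('g \<Rightarrow> 'h \<Rightarrow> 'h) \<Rightarrow>
   ('h \<Rightarrow> 'g) \<Rightarrow> bool" where
  "rb_operator G H \<Phi> B \<longleftrightarrow>
     smooth_map (lmfd H) (lmfd G) B \<and>
     (\<forall>h1\<in>carrier H. \<forall>h2\<in>carrier H. B h1 \<otimes>\<^bsub>G\<^esub> B h2 = B (h1 \<otimes>\<^bsub>H\<^esub> \<Phi> (B h1) h2))"

definition rb_hom ::
  "('g, 'e::real_inner) lie_grp \<Rightarrow> ('h, 'f::real_inner) lie_grp \<Rightarrow> ('g \<Rightarrow> 'h \<Rightarrow> 'h) \<Rightarrow>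
   ('h \<Rightarrow> 'g) \<Rightarrow> ('h \<Rightarrow> 'g) \<Rightarrow> ('g \<Rightarrow> 'g) \<Rightarrow> ('h \<Rightarrow> 'h) \<Rightarrow> bool" where
  "rb_hom G H \<Phi> B' B \<Psi>\<^sub>G \<Psi>\<^sub>H \<longleftrightarrow>
     rb_operator G H \<Phi> B' \<and> rb_operator G H \<Phi> B \<and>
     \<Psi>\<^sub>G \<in> lie_group_hom G G \<and> \<Psi>\<^sub>H \<in> lie_group_hom H H \<and>
     (\<forall>h\<in>carrier H. B (\<Psi>\<^sub>H h) = \<Psi>\<^sub>G (B' h)) \<and>
     (\<forall>g\<in>carrier G. \<forall>h\<in>carrier H. \<Psi>\<^sub>H (\<Phi> g h) = \<Phi> (\<Psi>\<^sub>G g) (\<Psi>\<^sub>H h))"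


section \<open>Relative Rota-Baxter operators on Lie algebras\<close>

record 'v lie_alg =
  lcarrier :: "'v set"
  ladd :: "'v \<Rightarrow> 'v \<Rightarrow> 'v"
  lscale :: "real \<Rightarrow> 'v \<Rightarrow> 'v"
  lbracket :: "'v \<Rightarrow> 'v \<Rightarrow> 'v"

abbreviation lminus :: "'v lie_alg \<Rightarrow> 'v \<Rightarrow> 'v \<Rightarrow> 'v" where
  "lminus L u v \<equiv> ladd L u (lscale L (-1) v)"

definition lie_alg_linear :: "'v lie_alg \<Rightarrow> 'w lie_alg \<Rightarrow> ('v \<Rightarrow> 'w) \<Rightarrow> bool" where
  "lie_alg_linear L K T \<longleftrightarrow>
     (\<forall>u\<in>lcarrier L. T u \<in> lcarrier K) \<and>
     (\<forall>u\<in>lcarrier L. \<forall>v\<in>lcarrier L. T (ladd L u v) = ladd K (T u) (T v)) \<and>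
     (\<forall>c. \<forall>u\<in>lcarrier L. T (lscale L c u) = lscale K c (T u))"

definition lie_alg_hom :: "'v lie_alg \<Rightarrow> 'w lie_alg \<Rightarrow> ('v \<Rightarrow> 'w) \<Rightarrow> bool" where
  "lie_alg_hom L K T \<longleftrightarrow> lie_alg_linear L K T \<and>
     (\<forall>u\<in>lcarrier L. \<forall>v\<in>lcarrier L. T (lbracket L u v) = lbracket K (T u) (T v))"

definition alg_rb_operator ::
  "'v lie_alg \<Rightarrow> 'w lie_alg \<Rightarrow> ('v \<Rightarrow> 'w \<Rightarrow> 'w) \<Rightarrow> ('w \<Rightarrow> 'v) \<Rightarrow> bool" where
  "alg_rb_operator \<gg> \<hh> \<phi> B \<longleftrightarrow>
     lie_alg_linear \<hh> \<gg> B \<and>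
     (\<forall>u\<in>lcarrier \<hh>. \<forall>v\<in>lcarrier \<hh>.
        lbracket \<gg> (B u) (B v) =
        B (ladd \<hh> (lminus \<hh> (\<phi> (B u) v) (\<phi> (B v) u)) (lbracket \<hh> u v)))"

definition alg_rb_hom ::
  "'v lie_alg \<Rightarrow> 'w lie_alg \<Rightarrow> ('v \<Rightarrow> 'w \<Rightarrow> 'w) \<Rightarrow> ('w \<Rightarrow> 'v) \<Rightarrow> ('w \<Rightarrow> 'v) \<Rightarrow>
   ('v \<Rightarrow> 'v) \<Rightarrow> ('w \<Rightarrow> 'w) \<Rightarrow> bool" where
  "alg_rb_hom \<gg> \<hh> \<phi> B' B \<psi>\<^sub>\<gg> \<psi>\<^sub>\<hh> \<longleftrightarrow>
     alg_rb_operator \<gg> \<hh> \<phi> B' \<and> alg_rb_operator \<gg> \<hh> \<phi> B \<and>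
     lie_alg_hom \<gg> \<gg> \<psi>\<^sub>\<gg> \<and> lie_alg_hom \<hh> \<hh> \<psi>\<^sub>\<hh> \<and>
     (\<forall>v\<in>lcarrier \<hh>. \<psi>\<^sub>\<gg> (B' v) = B (\<psi>\<^sub>\<hh> v)) \<and>
     (\<forall>x\<in>lcarrier \<gg>. \<forall>v\<in>lcarrier \<hh>. \<psi>\<^sub>\<hh> (\<phi> x v) = \<phi> (\<psi>\<^sub>\<gg> x) (\<psi>\<^sub>\<hh> v))"


section \<open>Differentiation\<close>

definition left_invariant_vf ::
  "('a, 'e::real_inner) lie_grp \<Rightarrow> (('a \<Rightarrow> real) \<Rightarrow> real) \<Rightarrow> 'a \<Rightarrow> ('a \<Rightarrow> real) \<Rightarrow> real" where
  "left_invariant_vf G X g = tangent_map (lmfd G) (lmfd G) (\<lambda>a. g \<otimes>\<^bsub>G\<^esub> a) \<one>\<^bsub>G\<^esub> X"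

definition lie_algebra_of ::
  "('a, 'e::real_inner) lie_grp \<Rightarrow> (('a \<Rightarrow> real) \<Rightarrow> real) lie_alg" where
  "lie_algebra_of G = \<lparr>
     lcarrier = tangent_space (lmfd G) \<one>\<^bsub>G\<^esub>,
     ladd = (\<lambda>X Y f. X f + Y f),
     lscale = (\<lambda>c X f. c * X f),
     lbracket = (\<lambda>X Y. vf_bracket (lmfd G) (left_invariant_vf G X) (left_invariant_vf G Y) \<one>\<^bsub>G\<^esub>)\<rparr>"

definition tangent_action ::
  "('h, 'f::real_inner) lie_grp \<Rightarrow> ('g \<Rightarrow> 'h \<Rightarrow> 'h) \<Rightarrow> 'g \<Rightarrow>
   (('h \<Rightarrow> real) \<Rightarrow> real) \<Rightarrow> ('h \<Rightarrow> real) \<Rightarrow> real" where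
  "tangent_action H \<Phi> g = tangent_map (lmfd H) (lmfd H) (\<Phi> g) \<one>\<^bsub>H\<^esub>"

text \<open>The differential at the identity of the map \<open>tangent_action H \<Phi>\<close> from \<open>G\<close> to the linear
  endomorphisms of \<open>\<hh>\<close>, the tangent spaces of the latter vector space being identified with the
  space itself. Since \<open>\<hh>\<close> is a finite-dimensional space of functionals \<open>f \<mapsto> w f\<close>, a map into its
  endomorphisms is differentiated componentwise, i.e. after evaluation at each \<open>v\<close> and \<open>f\<close>: for
  \<open>X = velocity (lmfd G) \<gamma>\<close>, the value at \<open>X\<close> and \<open>v\<close> is the derivative at 0 of the curve
  \<open>t \<mapsto> tangent_action H \<Phi> (\<gamma> t) v\<close> in \<open>\<hh>\<close>.\<close>

definition diff_action ::
  "('h, 'f::real_inner) lie_grp \<Rightarrow> ('g \<Rightarrow> 'h \<Rightarrow> 'h) \<Rightarrow>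
   (('g \<Rightarrow> real) \<Rightarrow> real) \<Rightarrow> (('h \<Rightarrow> real) \<Rightarrow> real) \<Rightarrow> ('h \<Rightarrow> real) \<Rightarrow> real" where
  "diff_action H \<Phi> X v = (\<lambda>f. X (\<lambda>g. tangent_action H \<Phi> g v f))"

end

theory Submission
  imports Defs
begin

text \<open>
  Every tangent vector is the velocity of a curve, and every operation of the statement is a
  derivative along curves. If \<open>X\<close> and \<open>Y\<close> are the velocities of \<open>\<alpha>\<close> and \<open>\<beta>\<close>, and \<open>D\<close> denotes
  \<open>\<partial>\<^sub>s \<partial>\<^sub>t\<close> at \<open>s = t = 0\<close> (\<open>mixed_deriv\<close> below), then on a function \<open>f\<close> that is smooth near the
  identity

    \<^item> the tangent map of \<open>F\<close> sends \<open>X\<close> to the velocity of \<open>F \<circ> \<alpha>\<close> (\<open>tangent_map_velocity\<close>);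
    \<^item> $[X, Y] f$ is the difference of $D f(\alpha(s) \beta(t))$ and $D f(\beta(s) \alpha(t))$
      (\<open>lbracket_velocity\<close>);
    \<^item> the differentiated action of $X$ on $Y$ sends \<open>f\<close> to $D f(\Phi(\alpha(s)) \beta(t))$
      (\<open>diff_action_velocity\<close>).

  With these formulas, everything that concerns the homomorphism $(\Psi_G, \Psi_H)$ follows by
  applying \<open>D\<close> to the global identities: multiplicativity of $\Psi_G$ and $\Psi_H$ gives Lie
  algebra homomorphisms, and the two compatibility conditions on the groups turn into those on the
  Lie algebras.

  That the tangent map of a Rota-Baxter operator $B$ is again one takes an argument. Put
  $K(a, b, t) = f(B(\alpha(a) \cdot \Phi(B(\alpha(b))) \beta(t)))$, a smooth function near
  $0 \in \mathbb{R}^3$. The Rota-Baxter identity says that $K(s, s, t)$ is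
  $f(B(\alpha(s)) \cdot B(\beta(t)))$. By the chain rule, the derivative of $\partial_t K(a, b, 0)$
  along the diagonal $a = b = s$ is the sum of its partial derivatives in $a$ and in $b$
  (\<open>mixed_deriv_diagonal\<close>). Because $B$ preserves the identity, these are the mixed
  derivatives of $f(B(\alpha(s) \beta(t)))$, which belongs to the bracket of $\mathfrak{h}$, and of
  $f(B(\Phi(B(\alpha(s))) \beta(t)))$, which belongs to the action. Antisymmetrizing in
  $\alpha, \beta$ gives the infinitesimal Rota-Baxter identity (\<open>mixed_deriv_rb_operator\<close>,
  \<open>alg_rb_operator_tangent_map\<close>).

  A tangent vector may only be evaluated on smooth functions, so the inner derivative must depend
  smoothly on the point; this is \<open>smooth_at_partial_deriv\<close>. It rests on the
  closure properties of smooth maps between manifolds (composition, pairing, projections), which in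
  turn rest on the chain rule for \<open>Ck_on\<close>.
\<close>

section \<open>Calculus of functions of class $C^k$\<close>

lemma Ck_on_subset: "Ck_on k S f \<Longrightarrow> T \<subseteq> S \<Longrightarrow> Ck_on k T f"
  by (induction k arbitrary: f) (auto intro: continuous_on_subset)

text \<open>Being of class $C^k$ can be checked in a neighbourhood of each point; maps between manifolds are
  analysed chart by chart through this.\<close>

lemma Ck_on_local:
  assumes "\<And>x. x \<in> S \<Longrightarrow> \<exists>T. open T \<and> x \<in> T \<and> Ck_on k T f"
  shows "Ck_on k S f"
  using assms
proof (induction k arbitrary: f)
  case 0
  have "isCont f x" if "x \<in> S" for x
    using 0[OF that] by (auto simp: continuous_on_eq_continuous_at)
  then show ?case by (simp add: continuous_at_imp_continuous_on)
next
  case (Suc k)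
  have "f differentiable (at x)" if "x \<in> S" for x
    using Suc.prems[OF that] by auto
  moreover have "Ck_on k S (\<lambda>x. frechet_derivative f (at x) v)" for v
    by (rule Suc.IH) (use Suc.prems in fastforce)
  ultimately show ?case by simp
qed

text \<open>Openness matters here: the derivatives of \<open>f\<close> and \<open>g\<close> at a point of
  \<open>S\<close> agree only because the two functions agree in a full neighbourhood.\<close>

lemma Ck_on_cong:
  assumes "open S" "\<And>x. x \<in> S \<Longrightarrow> f x = g x" "Ck_on k S f"
  shows "Ck_on k S g"
  using assms(2,3)
proof (induction k arbitrary: f g)
  case 0
  then show ?case by (metis Ck_on.simps(1) continuous_on_cong)
next
  case (Suc k)
  have d: "f differentiable (at x)" if "x \<in> S" for x
    using Suc.prems that by auto
  have "g differentiable (at x)" if "x \<in> S" for x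
    using d[OF that] has_derivative_transform_within_open[OF _ assms(1) that] Suc.prems(1)
    unfolding differentiable_def by blast
  moreover have "Ck_on k S (\<lambda>x. frechet_derivative g (at x) v)" for v
  proof (rule Suc.IH)
    show "Ck_on k S (\<lambda>x. frechet_derivative f (at x) v)" using Suc.prems(2) by simp
    show "frechet_derivative f (at x) v = frechet_derivative g (at x) v" if "x \<in> S" for x
      using frechet_derivative_transform_within_open[OF d[OF that] assms(1) that] Suc.prems(1)
      by simp
  qed
  ultimately show ?case by simp
qed

text \<open>Lets any explicit formula for the derivative stand in for \<open>frechet_derivative\<close>.\<close>

lemma Ck_on_SucI:
  assumes "open S" "\<And>x. x \<in> S \<Longrightarrow> (f has_derivative f' x) (at x)"
    and "\<And>v. Ck_on k S (\<lambda>x. f' x v)"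
  shows "Ck_on (Suc k) S f"
proof -
  have "Ck_on k S (\<lambda>x. frechet_derivative f (at x) v)" for v
    by (rule Ck_on_cong[OF assms(1) _ assms(3)[of v]])
      (metis assms(2) frechet_derivative_at)
  then show ?thesis using assms(2) by (auto simp: differentiable_def)
qed

lemma Ck_on_has_derivative:
  assumes "Ck_on (Suc k) S f" "x \<in> S"
  shows "(f has_derivative frechet_derivative f (at x)) (at x)"
  using assms by (simp add: frechet_derivative_works[symmetric])

lemma Ck_on_SucD: "Ck_on (Suc k) S f \<Longrightarrow> Ck_on k S f"
proof (induction k arbitrary: f)
  case 0
  then show ?case
    by (auto intro!: continuous_at_imp_continuous_on differentiable_imp_continuous_within)
next
  case (Suc k)
  then show ?case by (metis Ck_on.simps(2))
qed

lemma Ck_on_const: "Ck_on k S (\<lambda>x. c)"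
  by (induction k arbitrary: c) simp_all

lemma Ck_on_bounded_linear:
  assumes "open S" "bounded_linear L"
  shows "Ck_on k S L"
proof (cases k)
  case 0
  then show ?thesis
    using assms(2) by (simp add: linear_continuous_on)
next
  case (Suc j)
  show ?thesis
    unfolding Suc
    by (rule Ck_on_SucI[OF assms(1), where f' = "\<lambda>x. L"])
      (simp_all add: bounded_linear_imp_has_derivative[OF assms(2)] Ck_on_const)
qed

lemma Ck_on_add:
  assumes "open S" "Ck_on k S f" "Ck_on k S g"
  shows "Ck_on k S (\<lambda>x. f x + g x)"
  using assms(2,3)
proof (induction k arbitrary: f g)
  case 0
  then show ?case by (simp add: continuous_on_add)
next
  case (Suc k)
  show ?case
    by (rule Ck_on_SucI[OF assms(1)],
        rule has_derivative_add[OF Ck_on_has_derivative[OF Suc.prems(1)]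
          Ck_on_has_derivative[OF Suc.prems(2)]])
      (use Suc in auto)
qed

lemma Ck_on_sum:
  assumes "open S" "\<And>i. i \<in> I \<Longrightarrow> Ck_on k S (f i)"
  shows "Ck_on k S (\<lambda>x. \<Sum>i\<in>I. f i x)"
  using assms(2)
  by (induction I rule: infinite_finite_induct)
    (auto intro!: Ck_on_const Ck_on_add assms(1))

lemma Ck_on_scaleR:
  assumes "open S" "Ck_on k S f" "Ck_on k S g"
  shows "Ck_on k S (\<lambda>x. f x *\<^sub>R g x)"
  using assms(2,3)
proof (induction k arbitrary: f g)
  case 0
  then show ?case by (simp add: continuous_on_scaleR)
next
  case (Suc k)
  show ?case
    by (rule Ck_on_SucI[OF assms(1)],
        rule has_derivative_scaleR[OF Ck_on_has_derivative[OF Suc.prems(1)]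
          Ck_on_has_derivative[OF Suc.prems(2)]], assumption+,
        intro Ck_on_add assms(1) Suc.IH Ck_on_SucD[OF Suc.prems(1)] Ck_on_SucD[OF Suc.prems(2)])
      (use Suc.prems in auto)
qed

lemma Ck_on_Pair:
  assumes "open S" "Ck_on k S f" "Ck_on k S g"
  shows "Ck_on k S (\<lambda>x. (f x, g x))"
  using assms(2,3)
proof (induction k arbitrary: f g)
  case 0
  then show ?case by (simp add: continuous_on_Pair)
next
  case (Suc k)
  show ?case
    by (rule Ck_on_SucI[OF assms(1)],
        rule has_derivative_Pair[OF Ck_on_has_derivative[OF Suc.prems(1)]
          Ck_on_has_derivative[OF Suc.prems(2)]])
      (use Suc in auto)
qed

lemma Ck_on_linear_compose:
  assumes "open S" "bounded_linear L" "Ck_on k S f"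
  shows "Ck_on k S (\<lambda>x. L (f x))"
  using assms(3)
proof (induction k arbitrary: f)
  case 0
  then show ?case by (simp add: assms(2) bounded_linear.continuous_on)
next
  case (Suc k)
  show ?case
    by (rule Ck_on_SucI[OF assms(1)],
        rule bounded_linear.has_derivative[OF assms(2) Ck_on_has_derivative[OF Suc.prems]])
      (use Suc in auto)
qed

text \<open>Coordinates of a finite-dimensional inner product space as bounded linear functionals. The class
  \<open>euclidean_space\<close> excludes dimension 0, so an orthogonal spanning set takes the
  place of \<open>Basis\<close>; if it contains the zero vector, the corresponding coefficient
  is $0 / 0 = 0$.\<close>

lemma orthogonal_expansion:
  fixes B :: "'a::real_inner set"
  assumes "finite B" "span B = UNIV"
  obtains C :: "'a set" where "finite C" "\<And>w. w = (\<Sum>c\<in>C. ((c \<bullet> w) / (c \<bullet> c)) *\<^sub>R c)"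
proof -
  obtain C :: "'a set" where C: "finite C" "span C = UNIV" "pairwise orthogonal C"
    using basis_orthogonal[OF assms(1)] unfolding assms(2) by blast
  have "w = (\<Sum>c\<in>C. ((c \<bullet> w) / (c \<bullet> c)) *\<^sub>R c)" for w
  proof -
    obtain r where w: "w = (\<Sum>c\<in>C. r c *\<^sub>R c)"
      using span_finite[OF C(1)] unfolding C(2) by blast
    have "((c \<bullet> w) / (c \<bullet> c)) *\<^sub>R c = r c *\<^sub>R c" if c: "c \<in> C" for c
    proof -
      have "c \<bullet> w = (\<Sum>d\<in>C. r d * (c \<bullet> d))"
        by (subst w) (simp add: inner_sum_right)
      also have "\<dots> = (\<Sum>d\<in>C. if d = c then r c * (c \<bullet> c) else 0)"
        using C(3) c by (intro sum.cong) (auto simp: pairwise_def orthogonal_def)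
      also have "\<dots> = r c * (c \<bullet> c)" using C(1) c by simp
      finally show ?thesis by (cases "c = 0") auto
    qed
    then have "(\<Sum>c\<in>C. ((c \<bullet> w) / (c \<bullet> c)) *\<^sub>R c) = (\<Sum>c\<in>C. r c *\<^sub>R c)"
      by (rule sum.cong[OF refl])
    then show ?thesis using w by metis
  qed
  then show ?thesis by (rule that[OF C(1)])
qed

text \<open>The directional derivative of $f \circ g$ along $v$ is $f'(g(x)) (g'(x) v)$, where the direction
  $g'(x) v$ varies with $x$, while \<open>Ck_on\<close> speaks of fixed directions only.
  Expanding $g'(x) v$ in an orthogonal spanning set of the middle space rewrites it as a sum of
  products of a coordinate of $g'(x) v$ with a derivative of $f$ in a fixed direction, to which
  the induction hypothesis applies. This is where finite dimension enters.\<close>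

lemma Ck_on_compose:
  fixes g :: "'a::real_normed_vector \<Rightarrow> 'b::real_inner" and f :: "'b \<Rightarrow> 'c::real_normed_vector"
  assumes fin: "\<exists>B::'b set. finite B \<and> span B = UNIV"
    and S: "open S" and T: "open T" "g ` S \<subseteq> T"
    and g: "Ck_on k S g" and f: "Ck_on k T f"
  shows "Ck_on k S (\<lambda>x. f (g x))"
  using g f
proof (induction k arbitrary: f)
  case 0
  then show ?case using T(2) by (auto intro: continuous_on_compose2)
next
  case (Suc k)
  obtain B :: "'b set" where "finite B" "span B = UNIV" using fin by blast
  then obtain C :: "'b set" where "finite C"
    and C: "\<And>w. w = (\<Sum>c\<in>C. ((c \<bullet> w) / (c \<bullet> c)) *\<^sub>R c)"
    by (rule orthogonal_expansion) (rule that)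
  let ?g' = "\<lambda>x. frechet_derivative g (at x)" and ?f' = "\<lambda>y. frechet_derivative f (at y)"
  have gd: "(g has_derivative ?g' x) (at x)" if "x \<in> S" for x
    using Ck_on_has_derivative[OF Suc.prems(1) that] .
  have fd: "(f has_derivative ?f' y) (at y)" if "y \<in> T" for y
    using Ck_on_has_derivative[OF Suc.prems(2) that] .
  have sum_Ck: "Ck_on k S (\<lambda>x. \<Sum>c\<in>C. ((c \<bullet> ?g' x v) / (c \<bullet> c)) *\<^sub>R ?f' (g x) c)" for v
  proof (intro Ck_on_sum Ck_on_scaleR S Suc.IH)
    fix c
    show "Ck_on k S g" by (rule Ck_on_SucD[OF Suc.prems(1)])
    show "Ck_on k T (\<lambda>y. ?f' y c)" using Suc.prems(2) by simp
    have "bounded_linear (\<lambda>w. (c \<bullet> w) / (c \<bullet> c))"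
      by (rule bounded_linear_compose[OF bounded_linear_divide bounded_linear_inner_right])
    then show "Ck_on k S (\<lambda>x. (c \<bullet> ?g' x v) / (c \<bullet> c))"
      by (rule Ck_on_linear_compose[OF S]) (use Suc.prems(1) in simp)
  qed
  have sum_eq: "?f' (g x) (?g' x v) = (\<Sum>c\<in>C. ((c \<bullet> ?g' x v) / (c \<bullet> c)) *\<^sub>R ?f' (g x) c)"
    if "x \<in> S" for x v
  proof -
    have lin: "linear (?f' (g x))"
      using fd[of "g x"] T(2) that by (auto intro: has_derivative_linear)
    have "?f' (g x) (?g' x v) = ?f' (g x) (\<Sum>c\<in>C. ((c \<bullet> ?g' x v) / (c \<bullet> c)) *\<^sub>R c)"
      by (rule arg_cong[OF C])
    then show ?thesis
      by (simp only: linear_sum[OF lin] linear_cmul[OF lin])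
  qed
  have *: "Ck_on k S (\<lambda>x. ?f' (g x) (?g' x v))" for v
    by (rule Ck_on_cong[OF S sym[OF sum_eq] sum_Ck])
  show ?case
    by (rule Ck_on_SucI[OF S _ *], rule has_derivative_compose[OF gd fd]) (use T(2) in auto)
qed

section \<open>Charts and smooth maps between manifolds\<close>

lemma smooth_on_subset: "smooth_on S f \<Longrightarrow> T \<subseteq> S \<Longrightarrow> smooth_on T f"
  by (auto simp: smooth_on_def intro: Ck_on_subset)

lemma smooth_on_cong:
  "open S \<Longrightarrow> (\<And>x. x \<in> S \<Longrightarrow> f x = g x) \<Longrightarrow> smooth_on S f \<Longrightarrow> smooth_on S g"
  unfolding smooth_on_def by (metis Ck_on_cong)

lemma smooth_on_local:
  "(\<And>x. x \<in> S \<Longrightarrow> \<exists>T. open T \<and> x \<in> T \<and> smooth_on T f) \<Longrightarrow> smooth_on S f"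
  unfolding smooth_on_def by (metis Ck_on_local)

lemma smooth_on_compose:
  fixes g :: "'a::real_normed_vector \<Rightarrow> 'b::real_inner"
  assumes "\<exists>B::'b set. finite B \<and> span B = UNIV"
    "open S" "open T" "g ` S \<subseteq> T" "smooth_on S g" "smooth_on T f"
  shows "smooth_on S (\<lambda>x. f (g x))"
  unfolding smooth_on_def
proof
  show "Ck_on k S (\<lambda>x. f (g x))" for k
    by (rule Ck_on_compose[OF assms(1-4)]) (use assms(5,6) in \<open>simp_all add: smooth_on_def\<close>)
qed

lemma smooth_on_Pair:
  "open S \<Longrightarrow> smooth_on S f \<Longrightarrow> smooth_on S g \<Longrightarrow> smooth_on S (\<lambda>x. (f x, g x))"
  by (simp add: smooth_on_def Ck_on_Pair)

lemma smooth_on_bounded_linear: "open S \<Longrightarrow> bounded_linear L \<Longrightarrow> smooth_on S L"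
  by (simp add: smooth_on_def Ck_on_bounded_linear)

lemma smooth_on_const: "smooth_on S (\<lambda>x. c)"
  by (simp add: smooth_on_def Ck_on_const)

lemma smooth_on_frechet_derivative:
  assumes "smooth_on S f"
  shows "smooth_on S (\<lambda>x. frechet_derivative f (at x) v)"
  unfolding smooth_on_def
proof
  fix k
  have "Ck_on (Suc k) S f" using assms by (simp add: smooth_on_def)
  then show "Ck_on k S (\<lambda>x. frechet_derivative f (at x) v)" by simp
qed

lemma smooth_on_has_derivative:
  "smooth_on S f \<Longrightarrow> x \<in> S \<Longrightarrow> (f has_derivative frechet_derivative f (at x)) (at x)"
  unfolding smooth_on_def using Ck_on_has_derivative by blast

lemma smooth_manifold_chart:
  assumes "smooth_manifold M" "(U, x) \<in> atlas M"
  shows "openin (topo M) U" "open (x ` U)"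
    "homeomorphic_map (subtopology (topo M) U) (top_of_set (x ` U)) x"
proof -
  have "\<forall>(U, x)\<in>atlas M. openin (topo M) U \<and> open (x ` U) \<and>
        homeomorphic_map (subtopology (topo M) U) (top_of_set (x ` U)) x"
    using assms(1) unfolding smooth_manifold_def by (elim conjE)
  from bspec[OF this assms(2)] show "openin (topo M) U" "open (x ` U)"
    "homeomorphic_map (subtopology (topo M) U) (top_of_set (x ` U)) x"
    by simp_all
qed

lemma smooth_manifold_transition:
  assumes "smooth_manifold M" "(U, x) \<in> atlas M" "(V, y) \<in> atlas M"
  shows "smooth_on (x ` (U \<inter> V)) (y \<circ> inv_into U x)"
proof -
  have "\<forall>(U, x)\<in>atlas M. \<forall>(V, y)\<in>atlas M. smooth_on (x ` (U \<inter> V)) (y \<circ> inv_into U x)"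
    using assms(1) unfolding smooth_manifold_def by (elim conjE)
  from bspec[OF this assms(2)] assms(3) show ?thesis by fast
qed

lemma smooth_manifold_finite_dim:
  fixes M :: "('a, 'e::real_inner) mfd"
  assumes "smooth_manifold M"
  shows "\<exists>B::'e set. finite B \<and> span B = UNIV"
  using assms unfolding smooth_manifold_def by (elim conjE)

lemma smooth_manifold_cover:
  assumes "smooth_manifold M"
  shows "(\<Union>(U, x)\<in>atlas M. U) = topspace (topo M)"
  using assms unfolding smooth_manifold_def by (elim conjE)

lemma chart_inj_on:
  assumes "smooth_manifold M" "(U, x) \<in> atlas M"
  shows "inj_on x U"
proof -
  have "topspace (subtopology (topo M) U) = U"
    using openin_subset[OF smooth_manifold_chart(1)[OF assms]] by auto
  then show ?thesis
    using smooth_manifold_chart(3)[OF assms] by (simp add: homeomorphic_eq_everything_map)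
qed

lemma chart_image_open:
  assumes "smooth_manifold M" "(U, x) \<in> atlas M" "openin (topo M) W" "W \<subseteq> U"
  shows "open (x ` W)"
proof -
  have "open (x ` U)" by (rule smooth_manifold_chart(2)[OF assms(1,2)])
  moreover have "openin (top_of_set (x ` U)) (x ` W)"
  proof -
    have "openin (subtopology (topo M) U) W"
      using assms openin_open_subtopology[OF smooth_manifold_chart(1)[OF assms(1,2)]] by blast
    then show ?thesis
      using homeomorphic_imp_open_map[OF smooth_manifold_chart(3)[OF assms(1,2)]]
      by (simp add: open_map_def)
  qed
  ultimately show ?thesis by (simp add: openin_open_eq)
qed

lemma chart_exists:
  assumes "smooth_manifold M" "p \<in> topspace (topo M)"
  obtains U x where "(U, x) \<in> atlas M" "p \<in> U"
proof -
  have "p \<in> (\<Union>(U, x)\<in>atlas M. U)" using assms smooth_manifold_cover by metis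
  then show ?thesis using that by auto
qed

lemma smooth_map_onI:
  assumes "openin (topo M) S" "continuous_map (subtopology (topo M) S) (topo N) F"
    and "\<And>U x V y. (U, x) \<in> atlas M \<Longrightarrow> (V, y) \<in> atlas N \<Longrightarrow>
      smooth_on (x ` {p \<in> U \<inter> S. F p \<in> V}) (y \<circ> F \<circ> inv_into U x)"
  shows "smooth_map_on M N S F"
  unfolding smooth_map_on_def using assms by blast

lemma smooth_map_on_preimage_open:
  assumes "smooth_map_on M N S F" "openin (topo N) V"
  shows "openin (topo M) {p \<in> S. F p \<in> V}"
proof -
  have S: "openin (topo M) S" and c: "continuous_map (subtopology (topo M) S) (topo N) F"
    using assms(1) by (auto simp: smooth_map_on_def)
  have "topspace (subtopology (topo M) S) = S"
    using openin_subset[OF S] by auto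
  then have "openin (subtopology (topo M) S) {p \<in> S. F p \<in> V}"
    using openin_continuous_map_preimage[OF c assms(2)] by metis
  then show ?thesis using openin_open_subtopology[OF S] by blast
qed

lemma smooth_map_on_maps:
  assumes "smooth_map_on M N S F" "p \<in> S"
  shows "p \<in> topspace (topo M)" "F p \<in> topspace (topo N)"
proof -
  show p: "p \<in> topspace (topo M)"
    using assms(1)[unfolded smooth_map_on_def] openin_subset assms(2) by blast
  have "continuous_map (subtopology (topo M) S) (topo N) F" "p \<in> topspace (subtopology (topo M) S)"
    using assms p by (simp_all add: smooth_map_on_def)
  then show "F p \<in> topspace (topo N)"
    using continuous_map_image_subset_topspace by fast
qed

lemma smooth_map_on_chart:
  assumes "smooth_map_on M N S F" "(U, x) \<in> atlas M" "(V, y) \<in> atlas N"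
  shows "smooth_on (x ` {p \<in> U \<inter> S. F p \<in> V}) (y \<circ> F \<circ> inv_into U x)"
  using assms unfolding smooth_map_on_def by blast

lemma chart_preimage_open:
  assumes "smooth_map_on M N S F" "smooth_manifold M" "smooth_manifold N"
    and "(U, x) \<in> atlas M" "(V, y) \<in> atlas N"
  shows "open (x ` {p \<in> U \<inter> S. F p \<in> V})"
proof (rule chart_image_open[OF assms(2,4)])
  have "openin (topo M) (U \<inter> {p \<in> S. F p \<in> V})"
    by (intro openin_Int smooth_map_on_preimage_open[OF assms(1)] smooth_manifold_chart(1)[OF assms(3,5)]
        smooth_manifold_chart(1)[OF assms(2,4)])
  moreover have "U \<inter> {p \<in> S. F p \<in> V} = {p \<in> U \<inter> S. F p \<in> V}" by auto
  ultimately show "openin (topo M) {p \<in> U \<inter> S. F p \<in> V}" by simp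
qed auto

lemma smooth_map_on_subset:
  assumes "smooth_map_on M N S F" "openin (topo M) T" "T \<subseteq> S"
  shows "smooth_map_on M N T F"
proof -
  have "continuous_map (subtopology (topo M) T) (topo N) F"
    using assms(1)[unfolded smooth_map_on_def] assms(3) continuous_map_from_subtopology_mono
    by blast
  moreover have "smooth_on (x ` {p \<in> U \<inter> T. F p \<in> V}) (y \<circ> F \<circ> inv_into U x)"
    if "(U, x) \<in> atlas M" "(V, y) \<in> atlas N" for U x V y
    by (rule smooth_on_subset[OF smooth_map_on_chart[OF assms(1) that]]) (use assms(3) in auto)
  ultimately show ?thesis using assms(2) by (blast intro: smooth_map_onI)
qed

lemma smooth_map_on_cong:
  assumes F: "smooth_map_on M N S F" and "smooth_manifold M" "smooth_manifold N"
    and eq: "\<And>p. p \<in> S \<Longrightarrow> F p = F' p"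
  shows "smooth_map_on M N S F'"
proof -
  have c: "continuous_map (subtopology (topo M) S) (topo N) F'"
    by (rule continuous_map_eq[of _ _ F]) (use F eq in \<open>simp_all add: smooth_map_on_def\<close>)
  have "smooth_on (x ` {p \<in> U \<inter> S. F' p \<in> V}) (y \<circ> F' \<circ> inv_into U x)"
    if ch: "(U, x) \<in> atlas M" "(V, y) \<in> atlas N" for U x V y
  proof -
    have *: "{p \<in> U \<inter> S. F' p \<in> V} = {p \<in> U \<inter> S. F p \<in> V}" using eq by auto
    have inv: "inv_into U x (x q) = q" if "q \<in> U" for q
      using inv_into_f_f[OF chart_inj_on[OF assms(2) ch(1)] that] .
    have "(y \<circ> F \<circ> inv_into U x) z = (y \<circ> F' \<circ> inv_into U x) z"
      if "z \<in> x ` {p \<in> U \<inter> S. F p \<in> V}" for z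
      using that eq by (auto simp: inv)
    then show ?thesis
      unfolding *
      using smooth_on_cong[OF chart_preimage_open[OF F assms(2,3) ch] _
            smooth_map_on_chart[OF F ch]] by blast
  qed
  moreover have "openin (topo M) S" using F by (simp add: smooth_map_on_def)
  ultimately show ?thesis by (blast intro: smooth_map_onI c)
qed

text \<open>Near a given point, the coordinate expression of \<open>K \<circ> F\<close> factors through any
  chart of \<open>N\<close> around the image point, and smoothness is local.\<close>

lemma smooth_map_on_compose:
  fixes N :: "('b, 'f::real_inner) mfd"
  assumes M: "smooth_manifold M" and N: "smooth_manifold N" and P: "smooth_manifold P"
    and F: "smooth_map_on M N S F" and K: "smooth_map_on N P T K"
  shows "smooth_map_on M P {p \<in> S. F p \<in> T} (\<lambda>p. K (F p))"
proof -
  let ?R = "{p \<in> S. F p \<in> T}"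
  have T: "openin (topo N) T" using K by (simp add: smooth_map_on_def)
  have R: "openin (topo M) ?R" by (rule smooth_map_on_preimage_open[OF F T])
  have F': "smooth_map_on M N ?R F" by (rule smooth_map_on_subset[OF F R]) auto
  have "continuous_map (subtopology (topo M) ?R) (subtopology (topo N) T) F"
    using F' by (auto simp: smooth_map_on_def continuous_map_in_subtopology)
  then have c: "continuous_map (subtopology (topo M) ?R) (topo P) (\<lambda>p. K (F p))"
    using continuous_map_compose[of _ _ F _ K] K by (auto simp: smooth_map_on_def o_def)
  have "smooth_on (x ` {p \<in> U \<inter> ?R. K (F p) \<in> W}) (w \<circ> (\<lambda>p. K (F p)) \<circ> inv_into U x)"
    if ch: "(U, x) \<in> atlas M" "(W, w) \<in> atlas P" for U x W w
  proof (rule smooth_on_local)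
    fix z assume "z \<in> x ` {p \<in> U \<inter> ?R. K (F p) \<in> W}"
    then obtain p where z: "z = x p" and p: "p \<in> U" "p \<in> S" "F p \<in> T" "K (F p) \<in> W" by auto
    obtain V y where V: "(V, y) \<in> atlas N" "F p \<in> V"
      using chart_exists[OF N smooth_map_on_maps(2)[OF F p(2)]] .
    let ?Q = "{q \<in> U \<inter> S. F q \<in> V \<inter> {r \<in> T. K r \<in> W}}"
    have oW: "openin (topo N) (V \<inter> {r \<in> T. K r \<in> W})"
      by (intro openin_Int smooth_manifold_chart(1)[OF N V(1)]
          smooth_map_on_preimage_open[OF K smooth_manifold_chart(1)[OF P ch(2)]])
    have "openin (topo M) (U \<inter> {q \<in> S. F q \<in> V \<inter> {r \<in> T. K r \<in> W}})"
      by (intro openin_Int smooth_manifold_chart(1)[OF M ch(1)] smooth_map_on_preimage_open[OF F oW])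
    moreover have "U \<inter> {q \<in> S. F q \<in> V \<inter> {r \<in> T. K r \<in> W}} = ?Q" by auto
    ultimately have "openin (topo M) ?Q" by simp
    then have o: "open (x ` ?Q)"
      by (rule chart_image_open[OF M ch(1)]) auto
    have invx: "inv_into U x (x q) = q" if "q \<in> U" for q
      using inv_into_f_f[OF chart_inj_on[OF M ch(1)] that] .
    have invy: "inv_into V y (y q) = q" if "q \<in> V" for q
      using inv_into_f_f[OF chart_inj_on[OF N V(1)] that] .
    let ?g = "y \<circ> F \<circ> inv_into U x" and ?f = "w \<circ> K \<circ> inv_into V y"
    have "smooth_on (x ` ?Q) (\<lambda>z. ?f (?g z))"
    proof (rule smooth_on_compose[where g = ?g and f = ?f, OF _ o])
      show "\<exists>B::'f set. finite B \<and> span B = UNIV" by (rule smooth_manifold_finite_dim[OF N])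
      show "open (y ` {q \<in> V \<inter> T. K q \<in> W})" by (rule chart_preimage_open[OF K N P V(1) ch(2)])
      show "?g ` x ` ?Q \<subseteq> y ` {q \<in> V \<inter> T. K q \<in> W}" by (auto simp: invx)
      show "smooth_on (x ` ?Q) ?g"
        by (rule smooth_on_subset[OF smooth_map_on_chart[OF F ch(1) V(1)]]) auto
      show "smooth_on (y ` {q \<in> V \<inter> T. K q \<in> W}) ?f"
        by (rule smooth_map_on_chart[OF K V(1) ch(2)])
    qed
    moreover have "?f (?g z') = (w \<circ> (\<lambda>p. K (F p)) \<circ> inv_into U x) z'" if "z' \<in> x ` ?Q" for z'
      using that by (auto simp: invx invy)
    ultimately have "smooth_on (x ` ?Q) (w \<circ> (\<lambda>p. K (F p)) \<circ> inv_into U x)"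
      using smooth_on_cong[OF o, of "\<lambda>z. ?f (?g z)"] by blast
    then show "\<exists>T. open T \<and> z \<in> T \<and> smooth_on T (w \<circ> (\<lambda>p. K (F p)) \<circ> inv_into U x)"
      using z p V(2) by (intro exI[of _ "x ` ?Q"] conjI o imageI) auto
  qed
  then show ?thesis by (rule smooth_map_onI[OF R c])
qed

text \<open>In charts the identity is a transition map.\<close>

lemma smooth_map_on_id:
  assumes M: "smooth_manifold M"
  shows "smooth_map M M (\<lambda>p. p)"
proof -
  have "smooth_on (x ` {p \<in> U \<inter> topspace (topo M). p \<in> V}) (y \<circ> (\<lambda>p. p) \<circ> inv_into U x)"
    if ch: "(U, x) \<in> atlas M" "(V, y) \<in> atlas M" for U x V y
  proof -
    have "smooth_on (x ` (U \<inter> V)) (y \<circ> inv_into U x)"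
      by (rule smooth_manifold_transition[OF M ch])
    moreover have "x ` {p \<in> U \<inter> topspace (topo M). p \<in> V} \<subseteq> x ` (U \<inter> V)" by auto
    ultimately show ?thesis unfolding o_def by (rule smooth_on_subset)
  qed
  then show ?thesis by (intro smooth_map_onI) auto
qed

lemma smooth_map_on_const:
  assumes M: "smooth_manifold M" and "c \<in> topspace (topo N)"
  shows "smooth_map M N (\<lambda>p. c)"
  using assms(2) by (auto simp: smooth_map_on_def o_def smooth_on_const)

lemma topo_prod_mfd [simp]: "topo (prod_mfd M N) = prod_topology (topo M) (topo N)"
  by (simp add: prod_mfd_def)

lemma atlas_prod_mfd: "(W, w) \<in> atlas (prod_mfd M N) \<longleftrightarrow>
    (\<exists>U x V y. W = U \<times> V \<and> w = map_prod x y \<and> (U, x) \<in> atlas M \<and> (V, y) \<in> atlas N)"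
  by (auto simp: prod_mfd_def)

lemma smooth_map_on_Pair:
  assumes M: "smooth_manifold M" and N: "smooth_manifold N" and P: "smooth_manifold P"
    and F: "smooth_map_on M N S F" and K: "smooth_map_on M P S K"
  shows "smooth_map_on M (prod_mfd N P) S (\<lambda>p. (F p, K p))"
proof -
  have S: "openin (topo M) S" using F by (simp add: smooth_map_on_def)
  have c: "continuous_map (subtopology (topo M) S) (topo (prod_mfd N P)) (\<lambda>p. (F p, K p))"
    using F K by (simp add: smooth_map_on_def continuous_map_paired)
  have "smooth_on (x ` {p \<in> U \<inter> S. (F p, K p) \<in> V \<times> W})
      (map_prod y w \<circ> (\<lambda>p. (F p, K p)) \<circ> inv_into U x)"
    if ch: "(U, x) \<in> atlas M" "(V, y) \<in> atlas N" "(W, w) \<in> atlas P" for U x V y W w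
  proof -
    let ?A = "x ` {p \<in> U \<inter> S. F p \<in> V}" and ?B = "x ` {p \<in> U \<inter> S. K p \<in> W}"
    have A: "open ?A" by (rule chart_preimage_open[OF F M N ch(1,2)])
    have B: "open ?B" by (rule chart_preimage_open[OF K M P ch(1,3)])
    have "smooth_on (?A \<inter> ?B) (\<lambda>z. ((y \<circ> F \<circ> inv_into U x) z, (w \<circ> K \<circ> inv_into U x) z))"
      by (intro smooth_on_Pair open_Int A B
          smooth_on_subset[OF smooth_map_on_chart[OF F ch(1,2)] Int_lower1]
          smooth_on_subset[OF smooth_map_on_chart[OF K ch(1,3)] Int_lower2])
    moreover have "x ` {p \<in> U \<inter> S. (F p, K p) \<in> V \<times> W} \<subseteq> ?A \<inter> ?B" by auto
    ultimately show ?thesis unfolding o_def map_prod_simp by (rule smooth_on_subset)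
  qed
  note rep = this
  show ?thesis
  proof (rule smooth_map_onI[OF S c])
    fix U x Q q assume U: "(U, x) \<in> atlas M" and "(Q, q) \<in> atlas (prod_mfd N P)"
    then obtain V y W w where "Q = V \<times> W" "q = map_prod y w"
      and "(V, y) \<in> atlas N" "(W, w) \<in> atlas P"
      by (auto simp: atlas_prod_mfd)
    then show "smooth_on (x ` {p \<in> U \<inter> S. (F p, K p) \<in> Q}) (q \<circ> (\<lambda>p. (F p, K p)) \<circ> inv_into U x)"
      using rep[OF U] by simp
  qed
qed

section \<open>Products of manifolds\<close>

lemma second_countable_prod_topology:
  assumes "second_countable X" "second_countable Y"
  shows "second_countable (prod_topology X Y)"
proof -
  obtain A where A: "countable A" "\<And>V. V \<in> A \<Longrightarrow> openin X V"
    "\<And>U x. openin X U \<Longrightarrow> x \<in> U \<Longrightarrow> \<exists>V\<in>A. x \<in> V \<and> V \<subseteq> U"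
    using assms(1) unfolding second_countable_def by metis
  obtain B where B: "countable B" "\<And>V. V \<in> B \<Longrightarrow> openin Y V"
    "\<And>U x. openin Y U \<Longrightarrow> x \<in> U \<Longrightarrow> \<exists>V\<in>B. x \<in> V \<and> V \<subseteq> U"
    using assms(2) unfolding second_countable_def by metis
  let ?C = "(\<lambda>(U, V). U \<times> V) ` (A \<times> B)"
  have "\<exists>W\<in>?C. z \<in> W \<and> W \<subseteq> U" if "openin (prod_topology X Y) U" "z \<in> U" for U z
  proof -
    obtain x y where z: "z = (x, y)" by (cases z)
    obtain S T where "openin X S" "openin Y T" "x \<in> S" "y \<in> T" and ST: "S \<times> T \<subseteq> U"
      using \<open>openin (prod_topology X Y) U\<close> \<open>z \<in> U\<close> unfolding openin_prod_topology_alt z by metis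
    then obtain S' T' where "S' \<in> A" "x \<in> S'" "S' \<subseteq> S" "T' \<in> B" "y \<in> T'" "T' \<subseteq> T"
      using A(3) B(3) by metis
    then show ?thesis
      using ST z by (intro bexI[of _ "S' \<times> T'"]) auto
  qed
  moreover have "countable ?C" using A(1) B(1) by simp
  moreover have "openin (prod_topology X Y) W" if "W \<in> ?C" for W
    using that A(2) B(2) by (auto simp: openin_prod_Times_iff)
  ultimately show ?thesis unfolding second_countable_def by (intro exI[of _ ?C]) blast
qed

lemma second_countable_euclidean:
  "second_countable (euclidean :: 'a::second_countable_topology topology)"
proof -
  obtain B :: "'a set set" where B: "countable B" "\<And>C. C \<in> B \<Longrightarrow> open C"
    "\<And>S. open S \<Longrightarrow> \<exists>U. U \<subseteq> B \<and> S = \<Union>U"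
    by (rule univ_second_countable) (rule that)
  show ?thesis
    unfolding second_countable_def
  proof (intro exI[of _ B] conjI ballI allI impI)
    fix U :: "'a set" and x assume "openin euclidean U \<and> x \<in> U"
    then obtain \<U> where "\<U> \<subseteq> B" "U = \<Union>\<U>" "x \<in> U" using B(3)[of U] by auto
    then show "\<exists>V\<in>B. x \<in> V \<and> V \<subseteq> U" by blast
  qed (use B in auto)
qed

lemma smooth_on_fst:
  fixes f :: "'a::real_inner \<Rightarrow> 'c::real_normed_vector"
  assumes "\<exists>B::'a set. finite B \<and> span B = UNIV" "open S" "open T" "smooth_on S f"
  shows "smooth_on (S \<times> T) (\<lambda>z. f (fst z))"
  by (rule smooth_on_compose[where g = fst and f = f, OF assms(1) _ assms(2)])
    (use assms in \<open>auto intro!: open_Times smooth_on_bounded_linear bounded_linear_fst\<close>)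

lemma smooth_on_snd:
  fixes f :: "'b::real_inner \<Rightarrow> 'c::real_normed_vector"
  assumes "\<exists>B::'b set. finite B \<and> span B = UNIV" "open S" "open T" "smooth_on T f"
  shows "smooth_on (S \<times> T) (\<lambda>z. f (snd z))"
  by (rule smooth_on_compose[where g = snd and f = f, OF assms(1) _ assms(3)])
    (use assms in \<open>auto intro!: open_Times smooth_on_bounded_linear bounded_linear_snd\<close>)

lemma inv_into_map_prod:
  assumes "inj_on x U" "inj_on y V" "a \<in> x ` U" "b \<in> y ` V"
  shows "inv_into (U \<times> V) (map_prod x y) (a, b) = (inv_into U x a, inv_into V y b)"
  by (rule inv_into_f_eq)
    (use assms in \<open>auto intro: map_prod_inj_on inv_into_into simp: f_inv_into_f\<close>)

text \<open>The mixed derivatives below involve maps on \<open>G \<times> H\<close>, $M \times \mathbb{R}$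
  and $\mathbb{R}^3$. Making all of them manifolds lets one composition rule handle every case.\<close>

lemma smooth_manifold_prod:
  fixes M :: "('a, 'e::real_inner) mfd" and N :: "('b, 'f::real_inner) mfd"
  assumes M: "smooth_manifold M" and N: "smooth_manifold N"
  shows "smooth_manifold (prod_mfd M N)"
  unfolding smooth_manifold_def
proof (intro conjI)
  obtain A :: "'e set" and B :: "'f set" where "finite A" "finite B"
    and span: "span A = UNIV" "span B = UNIV"
    using smooth_manifold_finite_dim[OF M] smooth_manifold_finite_dim[OF N] by auto
  let ?C = "(\<lambda>a. (a, 0)) ` A \<union> (\<lambda>b. (0, b)) ` B"
  have l: "linear (\<lambda>a::'e. (a, 0::'f))" "linear (\<lambda>b::'f. (0::'e, b))"
    by (auto intro!: linearI)
  have "(a, b) \<in> span ?C" for a b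
  proof -
    have "(a, 0) \<in> span ?C"
      using linear_span_image[OF l(1), of A] span(1) span_mono[of "(\<lambda>a. (a, 0)) ` A" ?C] by auto
    moreover have "(0, b) \<in> span ?C"
      using linear_span_image[OF l(2), of B] span(2) span_mono[of "(\<lambda>b. (0, b)) ` B" ?C] by auto
    ultimately have "(a, 0) + (0, b) \<in> span ?C" by (rule span_add)
    then show ?thesis by simp
  qed
  then have "span ?C = UNIV" by auto
  then show "\<exists>B::('e \<times> 'f) set. finite B \<and> span B = UNIV"
    using \<open>finite A\<close> \<open>finite B\<close> by (intro exI[of _ ?C]) auto
  show "Hausdorff_space (topo (prod_mfd M N))" "second_countable (topo (prod_mfd M N))"
    using M N by (simp_all add: smooth_manifold_def Hausdorff_space_prod_topology
        second_countable_prod_topology)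
  show "(\<Union>(U, x)\<in>atlas (prod_mfd M N). U) = topspace (topo (prod_mfd M N))"
  proof (intro equalityI subsetI)
    fix z assume "z \<in> (\<Union>(U, x)\<in>atlas (prod_mfd M N). U)"
    then obtain U x V y where "z \<in> U \<times> V" and ch: "(U, x) \<in> atlas M" "(V, y) \<in> atlas N"
      by (auto simp: atlas_prod_mfd)
    then show "z \<in> topspace (topo (prod_mfd M N))"
      using openin_subset[OF smooth_manifold_chart(1)[OF M ch(1)]]
        openin_subset[OF smooth_manifold_chart(1)[OF N ch(2)]] by auto
  next
    fix z assume "z \<in> topspace (topo (prod_mfd M N))"
    then have z: "fst z \<in> topspace (topo M)" "snd z \<in> topspace (topo N)" by auto
    obtain U x where U: "(U, x) \<in> atlas M" "fst z \<in> U" using chart_exists[OF M z(1)] .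
    obtain V y where V: "(V, y) \<in> atlas N" "snd z \<in> V" using chart_exists[OF N z(2)] .
    have "(U \<times> V, map_prod x y) \<in> atlas (prod_mfd M N)"
      using U(1) V(1) by (auto simp: atlas_prod_mfd)
    moreover have "z \<in> U \<times> V" using U(2) V(2) by (simp add: mem_Times_iff)
    ultimately show "z \<in> (\<Union>(U, x)\<in>atlas (prod_mfd M N). U)" by fast
  qed
  have im: "map_prod x y ` (U \<times> V) = x ` U \<times> y ` V" for x :: "'a \<Rightarrow> 'e" and y :: "'b \<Rightarrow> 'f" and U V
    by auto
  show "\<forall>(Q, q)\<in>atlas (prod_mfd M N). openin (topo (prod_mfd M N)) Q \<and> open (q ` Q) \<and>
      homeomorphic_map (subtopology (topo (prod_mfd M N)) Q) (top_of_set (q ` Q)) q"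
  proof (intro ballI, clarify)
    fix Q q assume "(Q, q) \<in> atlas (prod_mfd M N)"
    then obtain U x V y where Q: "Q = U \<times> V" "q = map_prod x y"
      and ch: "(U, x) \<in> atlas M" "(V, y) \<in> atlas N"
      by (auto simp: atlas_prod_mfd)
    note chM = smooth_manifold_chart[OF M ch(1)] and chN = smooth_manifold_chart[OF N ch(2)]
    obtain x' where "homeomorphic_maps (subtopology (topo M) U) (top_of_set (x ` U)) x x'"
      using chM(3) homeomorphic_map_maps by metis
    moreover obtain y' where "homeomorphic_maps (subtopology (topo N) V) (top_of_set (y ` V)) y y'"
      using chN(3) homeomorphic_map_maps by metis
    ultimately have "homeomorphic_maps
        (prod_topology (subtopology (topo M) U) (subtopology (topo N) V))
        (prod_topology (top_of_set (x ` U)) (top_of_set (y ` V)))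
        (\<lambda>(a, b). (x a, y b)) (\<lambda>(a, b). (x' a, y' b))"
      by (simp only: homeomorphic_maps_prod simp_thms)
    then have "homeomorphic_map (subtopology (topo (prod_mfd M N)) Q) (top_of_set (q ` Q)) q"
      unfolding Q im
      by (auto simp: homeomorphic_map_maps subtopology_Times map_prod_def)
    then show "openin (topo (prod_mfd M N)) Q \<and> open (q ` Q) \<and>
        homeomorphic_map (subtopology (topo (prod_mfd M N)) Q) (top_of_set (q ` Q)) q"
      using chM(1,2) chN(1,2) by (simp add: Q im open_Times openin_prod_Times_iff)
  qed
  show "\<forall>(Q, q)\<in>atlas (prod_mfd M N). \<forall>(R, r)\<in>atlas (prod_mfd M N).
      smooth_on (q ` (Q \<inter> R)) (r \<circ> inv_into Q q)"
  proof (intro ballI, clarify)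
    fix Q q R r
    assume "(Q, q) \<in> atlas (prod_mfd M N)" "(R, r) \<in> atlas (prod_mfd M N)"
    then obtain U x V y U' x' V' y' where Q: "Q = U \<times> V" "q = map_prod x y"
      and R: "R = U' \<times> V'" "r = map_prod x' y'"
      and ch: "(U, x) \<in> atlas M" "(V, y) \<in> atlas N" "(U', x') \<in> atlas M" "(V', y') \<in> atlas N"
      by (auto simp: atlas_prod_mfd)
    have A: "open (x ` (U \<inter> U'))"
      by (intro chart_image_open[OF M ch(1)] openin_Int Int_lower1
          smooth_manifold_chart(1)[OF M ch(1)] smooth_manifold_chart(1)[OF M ch(3)])
    have B: "open (y ` (V \<inter> V'))"
      by (intro chart_image_open[OF N ch(2)] openin_Int Int_lower1
          smooth_manifold_chart(1)[OF N ch(2)] smooth_manifold_chart(1)[OF N ch(4)])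
    let ?h = "\<lambda>z. ((x' \<circ> inv_into U x) (fst z), (y' \<circ> inv_into V y) (snd z))"
    have "smooth_on (x ` (U \<inter> U') \<times> y ` (V \<inter> V')) ?h"
      by (intro smooth_on_Pair open_Times smooth_on_fst smooth_on_snd A B
          smooth_manifold_finite_dim[OF M] smooth_manifold_finite_dim[OF N]
          smooth_manifold_transition[OF M] smooth_manifold_transition[OF N] ch)
    moreover have "?h z = (r \<circ> inv_into Q q) z" if zin: "z \<in> x ` (U \<inter> U') \<times> y ` (V \<inter> V')" for z
    proof -
      obtain a b where z: "z = (a, b)" "a \<in> x ` U" "b \<in> y ` V" using zin by auto
      then show ?thesis
        using inv_into_map_prod[OF chart_inj_on[OF M ch(1)] chart_inj_on[OF N ch(2)] z(2,3)]
        unfolding Q R by simp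
    qed
    ultimately have "smooth_on (x ` (U \<inter> U') \<times> y ` (V \<inter> V')) (r \<circ> inv_into Q q)"
      using smooth_on_cong[OF open_Times[OF A B], of ?h] by blast
    moreover have "q ` (Q \<inter> R) = x ` (U \<inter> U') \<times> y ` (V \<inter> V')"
      unfolding Q R Times_Int_Times im by (rule refl)
    ultimately show "smooth_on (q ` (Q \<inter> R)) (r \<circ> inv_into Q q)" by (simp only:)
  qed
qed

lemma smooth_manifold_real: "smooth_manifold real_mfd"
proof -
  have "span {1} = (UNIV :: real set)" by (auto simp: span_singleton)
  then have "\<exists>B::real set. finite B \<and> span B = UNIV" by (intro exI[of _ "{1}"]) auto
  moreover have "smooth_on UNIV (id :: real \<Rightarrow> real)"
    using smooth_on_bounded_linear[OF open_UNIV bounded_linear_ident] by (simp add: id_def)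
  moreover have "homeomorphic_map (subtopology euclidean UNIV) (top_of_set (id ` UNIV)) (id :: real \<Rightarrow> real)"
    by simp
  ultimately show ?thesis
    unfolding smooth_manifold_def real_mfd_def
    by (intro conjI) (simp_all add: second_countable_euclidean)
qed

lemma smooth_map_fst:
  assumes M: "smooth_manifold M" and N: "smooth_manifold N"
  shows "smooth_map (prod_mfd M N) M fst"
proof (rule smooth_map_onI)
  show "continuous_map (subtopology (topo (prod_mfd M N)) (topspace (topo (prod_mfd M N)))) (topo M) fst"
    by (simp add: continuous_map_subtopology_fst)
next
  fix Q q R r assume "(Q, q) \<in> atlas (prod_mfd M N)" and R: "(R, r) \<in> atlas M"
  then obtain U x V y where Q: "Q = U \<times> V" "q = map_prod x y"
    and ch: "(U, x) \<in> atlas M" "(V, y) \<in> atlas N"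
    by (auto simp: atlas_prod_mfd)
  have A: "open (x ` (U \<inter> R))"
    by (intro chart_image_open[OF M ch(1)] openin_Int Int_lower1
        smooth_manifold_chart(1)[OF M ch(1)] smooth_manifold_chart(1)[OF M R])
  have B: "open (y ` V)" by (rule smooth_manifold_chart(2)[OF N ch(2)])
  have "smooth_on (x ` (U \<inter> R) \<times> y ` V) (\<lambda>z. (r \<circ> inv_into U x) (fst z))"
    by (intro smooth_on_fst smooth_manifold_finite_dim[OF M] A B
        smooth_manifold_transition[OF M ch(1) R])
  moreover have "(r \<circ> inv_into U x) (fst z) = (r \<circ> fst \<circ> inv_into Q q) z"
    if zin: "z \<in> x ` (U \<inter> R) \<times> y ` V" for z
  proof -
    obtain a b where z: "z = (a, b)" "a \<in> x ` U" "b \<in> y ` V" using zin by auto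
    then show ?thesis
      using inv_into_map_prod[OF chart_inj_on[OF M ch(1)] chart_inj_on[OF N ch(2)] z(2,3)]
      unfolding Q by simp
  qed
  ultimately have "smooth_on (x ` (U \<inter> R) \<times> y ` V) (r \<circ> fst \<circ> inv_into Q q)"
    using smooth_on_cong[OF open_Times[OF A B], of "\<lambda>z. (r \<circ> inv_into U x) (fst z)"] by blast
  then show "smooth_on (q ` {p \<in> Q \<inter> topspace (topo (prod_mfd M N)). fst p \<in> R})
      (r \<circ> fst \<circ> inv_into Q q)"
    by (rule smooth_on_subset) (auto simp: Q)
qed (simp add: openin_prod_Times_iff)

lemma smooth_map_snd:
  assumes M: "smooth_manifold M" and N: "smooth_manifold N"
  shows "smooth_map (prod_mfd M N) N snd"
proof (rule smooth_map_onI)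
  show "continuous_map (subtopology (topo (prod_mfd M N)) (topspace (topo (prod_mfd M N)))) (topo N) snd"
    by (simp add: continuous_map_subtopology_snd)
next
  fix Q q R r assume "(Q, q) \<in> atlas (prod_mfd M N)" and R: "(R, r) \<in> atlas N"
  then obtain U x V y where Q: "Q = U \<times> V" "q = map_prod x y"
    and ch: "(U, x) \<in> atlas M" "(V, y) \<in> atlas N"
    by (auto simp: atlas_prod_mfd)
  have A: "open (x ` U)" by (rule smooth_manifold_chart(2)[OF M ch(1)])
  have B: "open (y ` (V \<inter> R))"
    by (intro chart_image_open[OF N ch(2)] openin_Int Int_lower1
        smooth_manifold_chart(1)[OF N ch(2)] smooth_manifold_chart(1)[OF N R])
  have "smooth_on (x ` U \<times> y ` (V \<inter> R)) (\<lambda>z. (r \<circ> inv_into V y) (snd z))"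
    by (intro smooth_on_snd smooth_manifold_finite_dim[OF N] A B
        smooth_manifold_transition[OF N ch(2) R])
  moreover have "(r \<circ> inv_into V y) (snd z) = (r \<circ> snd \<circ> inv_into Q q) z"
    if zin: "z \<in> x ` U \<times> y ` (V \<inter> R)" for z
  proof -
    obtain a b where z: "z = (a, b)" "a \<in> x ` U" "b \<in> y ` V" using zin by auto
    then show ?thesis
      using inv_into_map_prod[OF chart_inj_on[OF M ch(1)] chart_inj_on[OF N ch(2)] z(2,3)]
      unfolding Q by simp
  qed
  ultimately have "smooth_on (x ` U \<times> y ` (V \<inter> R)) (r \<circ> snd \<circ> inv_into Q q)"
    using smooth_on_cong[OF open_Times[OF A B], of "\<lambda>z. (r \<circ> inv_into V y) (snd z)"] by blast
  then show "smooth_on (q ` {p \<in> Q \<inter> topspace (topo (prod_mfd M N)). snd p \<in> R})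
      (r \<circ> snd \<circ> inv_into Q q)"
    by (rule smooth_on_subset) (auto simp: Q)
qed (simp add: openin_prod_Times_iff)

section \<open>Smoothness at a point\<close>

text \<open>The open set is existentially quantified, so that domains need not be tracked through
  compositions; for real-valued maps this is membership in \<open>smooth_near\<close>.\<close>

definition smooth_at ::
  "('a, 'e::real_inner) mfd \<Rightarrow> ('b, 'f::real_inner) mfd \<Rightarrow> 'a \<Rightarrow> ('a \<Rightarrow> 'b) \<Rightarrow> bool" where
  "smooth_at M N p F \<longleftrightarrow> (\<exists>S. p \<in> S \<and> smooth_map_on M N S F)"

lemma smooth_near_iff: "f \<in> smooth_near M p \<longleftrightarrow> smooth_at M real_mfd p f"
  by (simp add: smooth_near_def smooth_at_def)

lemma smooth_atI: "smooth_map_on M N S F \<Longrightarrow> p \<in> S \<Longrightarrow> smooth_at M N p F"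
  by (auto simp: smooth_at_def)

lemma smooth_at_maps:
  assumes "smooth_at M N p F"
  shows "p \<in> topspace (topo M)" "F p \<in> topspace (topo N)"
  using assms smooth_map_on_maps unfolding smooth_at_def by metis+

lemma smooth_at_preimage:
  assumes "smooth_at M N p F" "openin (topo N) V" "F p \<in> V"
  obtains S where "openin (topo M) S" "p \<in> S" "\<And>q. q \<in> S \<Longrightarrow> F q \<in> V"
proof -
  obtain S where "p \<in> S" "smooth_map_on M N S F" using assms(1) by (auto simp: smooth_at_def)
  then show ?thesis
    using that[of "{q \<in> S. F q \<in> V}"] smooth_map_on_preimage_open assms(2,3) by blast
qed

lemma smooth_at_eventually:
  assumes "smooth_at real_mfd N t F" "openin (topo N) V" "F t \<in> V"
  shows "\<forall>\<^sub>F s in nhds t. F s \<in> V"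
proof -
  obtain S where "openin (topo real_mfd) S" "t \<in> S" "\<And>q. q \<in> S \<Longrightarrow> F q \<in> V"
    using smooth_at_preimage[OF assms] by blast
  then show ?thesis unfolding eventually_nhds real_mfd_def by auto
qed

text \<open>The values of a function away from a neighbourhood, in particular outside the manifold, do not
  affect its smoothness at a point.\<close>

lemma smooth_at_cong:
  assumes "smooth_at M N p F" "smooth_manifold M" "smooth_manifold N"
    and "openin (topo M) V" "p \<in> V" "\<And>q. q \<in> V \<Longrightarrow> F q = F' q"
  shows "smooth_at M N p F'"
proof -
  obtain S where S: "p \<in> S" "smooth_map_on M N S F" using assms(1) by (auto simp: smooth_at_def)
  have "openin (topo M) (S \<inter> V)"
    using S(2) assms(4) by (auto simp: smooth_map_on_def)
  then have "smooth_map_on M N (S \<inter> V) F" using smooth_map_on_subset[OF S(2)] by blast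
  then have "smooth_map_on M N (S \<inter> V) F'"
    by (rule smooth_map_on_cong[OF _ assms(2,3)]) (use assms(6) in blast)
  then show ?thesis using S(1) assms(5) by (auto intro: smooth_atI)
qed

lemma smooth_at_compose:
  assumes "smooth_at M N p F" "smooth_at N P (F p) K"
    and "smooth_manifold M" "smooth_manifold N" "smooth_manifold P"
  shows "smooth_at M P p (\<lambda>q. K (F q))"
proof -
  obtain S where S: "p \<in> S" "smooth_map_on M N S F" using assms(1) by (auto simp: smooth_at_def)
  obtain T where T: "F p \<in> T" "smooth_map_on N P T K" using assms(2) by (auto simp: smooth_at_def)
  show ?thesis
    by (rule smooth_atI[OF smooth_map_on_compose[OF assms(3-5) S(2) T(2)]]) (use S(1) T(1) in auto)
qed

lemma smooth_at_Pair:
  assumes "smooth_at M N p F" "smooth_at M P p K"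
    and "smooth_manifold M" "smooth_manifold N" "smooth_manifold P"
  shows "smooth_at M (prod_mfd N P) p (\<lambda>q. (F q, K q))"
proof -
  obtain S where S: "p \<in> S" "smooth_map_on M N S F" using assms(1) by (auto simp: smooth_at_def)
  obtain T where T: "p \<in> T" "smooth_map_on M P T K" using assms(2) by (auto simp: smooth_at_def)
  have "openin (topo M) (S \<inter> T)"
    using S(2) T(2) by (auto simp: smooth_map_on_def)
  then have "smooth_map_on M N (S \<inter> T) F" "smooth_map_on M P (S \<inter> T) K"
    using smooth_map_on_subset[OF S(2)] smooth_map_on_subset[OF T(2)] by blast+
  from smooth_map_on_Pair[OF assms(3-5) this] show ?thesis
    by (rule smooth_atI) (use S(1) T(1) in auto)
qed

lemma smooth_at_id: "smooth_manifold M \<Longrightarrow> p \<in> topspace (topo M) \<Longrightarrow> smooth_at M M p (\<lambda>q. q)"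
  by (rule smooth_atI[OF smooth_map_on_id])

lemma smooth_at_const:
  "smooth_manifold M \<Longrightarrow> p \<in> topspace (topo M) \<Longrightarrow> c \<in> topspace (topo N) \<Longrightarrow>
     smooth_at M N p (\<lambda>q. c)"
  by (rule smooth_atI[OF smooth_map_on_const])

lemma smooth_at_fst:
  assumes "smooth_at M (prod_mfd N P) p F"
    and "smooth_manifold M" "smooth_manifold N" "smooth_manifold P"
  shows "smooth_at M N p (\<lambda>q. fst (F q))"
  by (rule smooth_at_compose[OF assms(1) smooth_atI[OF smooth_map_fst]])
    (use assms smooth_at_maps(2)[OF assms(1)] smooth_manifold_prod in auto)

lemma smooth_at_snd:
  assumes "smooth_at M (prod_mfd N P) p F"
    and "smooth_manifold M" "smooth_manifold N" "smooth_manifold P"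
  shows "smooth_at M P p (\<lambda>q. snd (F q))"
  by (rule smooth_at_compose[OF assms(1) smooth_atI[OF smooth_map_snd]])
    (use assms smooth_at_maps(2)[OF assms(1)] smooth_manifold_prod in auto)

text \<open>For real-valued functions continuity need not be checked separately, since it can be read off in
  charts.\<close>

lemma smooth_map_on_realI:
  assumes M: "smooth_manifold M" and S: "openin (topo M) S"
    and h: "\<And>U x. (U, x) \<in> atlas M \<Longrightarrow> smooth_on (x ` (U \<inter> S)) (h \<circ> inv_into U x)"
  shows "smooth_map_on M real_mfd S h"
proof (rule smooth_map_onI[OF S])
  have nbhd: "\<exists>T. openin (topo M) T \<and> p \<in> T \<and> T \<subseteq> {p \<in> S. h p \<in> V}"
    if p: "p \<in> S" "h p \<in> V" and V: "open V" for p V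
  proof -
    have "p \<in> topspace (topo M)" using openin_subset[OF S] p(1) by blast
    then obtain U x where ch: "(U, x) \<in> atlas M" "p \<in> U" using chart_exists[OF M] by metis
    have U: "openin (topo M) U" by (rule smooth_manifold_chart(1)[OF M ch(1)])
    have top: "topspace (subtopology (topo M) U) = U" using openin_subset[OF U] by auto
    have inv: "inv_into U x (x q) = q" if "q \<in> U" for q
      using inv_into_f_f[OF chart_inj_on[OF M ch(1)] that] .
    have o: "open (x ` (U \<inter> S))"
      by (intro chart_image_open[OF M ch(1)] openin_Int U S Int_lower1)
    have "continuous_on (x ` (U \<inter> S)) (h \<circ> inv_into U x)"
      using h[OF ch(1)] unfolding smooth_on_def by (metis Ck_on.simps(1))
    then have A: "open ((h \<circ> inv_into U x) -` V \<inter> x ` (U \<inter> S))" (is "open ?A")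
      using V unfolding continuous_on_open_vimage[OF o] by blast
    have "continuous_map (subtopology (topo M) U) euclidean x"
      using smooth_manifold_chart(3)[OF M ch(1)] homeomorphic_imp_continuous_map
        continuous_map_into_fulltopology by blast
    then have "openin (subtopology (topo M) U) {q \<in> topspace (subtopology (topo M) U). x q \<in> ?A}"
      by (rule openin_continuous_map_preimage) (use A in simp)
    then have "openin (subtopology (topo M) U) {q \<in> U. x q \<in> ?A}"
      unfolding top .
    then have "openin (topo M) {q \<in> U. x q \<in> ?A}"
      using openin_open_subtopology[OF U] by blast
    moreover have "p \<in> {q \<in> U. x q \<in> ?A}" using p ch(2) by (auto simp: inv)
    moreover have "{q \<in> U. x q \<in> ?A} \<subseteq> {p \<in> S. h p \<in> V}"
    proof
      fix q assume q: "q \<in> {q \<in> U. x q \<in> ?A}"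
      then have "q \<in> U" "h (inv_into U x (x q)) \<in> V" and im: "x q \<in> x ` (U \<inter> S)" by auto
      then have "h q \<in> V" using inv by metis
      moreover have "q \<in> S"
        using inj_on_image_mem_iff[OF chart_inj_on[OF M ch(1)] \<open>q \<in> U\<close> Int_lower1[of U S]] im by blast
      ultimately show "q \<in> {p \<in> S. h p \<in> V}" by blast
    qed
    ultimately show ?thesis by blast
  qed
  have "topspace (subtopology (topo M) S) = S" using openin_subset[OF S] by auto
  moreover have "openin (topo M) {p \<in> S. h p \<in> V}" if "open V" for V
    using nbhd[OF _ _ that] by (subst openin_subopen) blast
  ultimately show "continuous_map (subtopology (topo M) S) (topo real_mfd) h"
    unfolding continuous_map openin_open_subtopology[OF S]
    by (auto simp: real_mfd_def continuous_map_def openin_open_subtopology[OF S])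
next
  fix U x V y assume ch: "(U, x) \<in> atlas M" and V: "(V, y) \<in> atlas real_mfd"
  have "{p \<in> U \<inter> S. h p \<in> V} = U \<inter> S" "y \<circ> h \<circ> inv_into U x = h \<circ> inv_into U x"
    using V by (auto simp: real_mfd_def)
  then show "smooth_on (x ` {p \<in> U \<inter> S. h p \<in> V}) (y \<circ> h \<circ> inv_into U x)"
    using h[OF ch] by (simp only:)
qed

lemma deriv_along_line:
  fixes G :: "'e::real_normed_vector \<Rightarrow> real"
  assumes "G differentiable (at a)"
  shows "deriv (\<lambda>t. G (a + t *\<^sub>R v)) 0 = frechet_derivative G (at a) v"
proof -
  let ?G' = "frechet_derivative G (at a)"
  have G: "(G has_derivative ?G') (at a)" using assms frechet_derivative_works by blast
  have "((\<lambda>t::real. a + t *\<^sub>R v) has_derivative (\<lambda>h. h *\<^sub>R v)) (at 0)"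
    by (auto intro!: derivative_eq_intros)
  moreover have "(G has_derivative ?G') (at (a + 0 *\<^sub>R v))" using G by simp
  ultimately have "((\<lambda>t. G (a + t *\<^sub>R v)) has_derivative (\<lambda>h. ?G' (h *\<^sub>R v))) (at 0)"
    by (rule has_derivative_compose)
  moreover have "?G' (h *\<^sub>R v) = ?G' v * h" for h
    using linear_cmul[OF has_derivative_linear[OF G], of h v] by simp
  ultimately have "((\<lambda>t. G (a + t *\<^sub>R v)) has_field_derivative ?G' v) (at 0)"
    by (simp add: has_field_derivative_def)
  then show ?thesis by (rule DERIV_imp_deriv)
qed

text \<open>In a product chart, the partial derivative in the real variable is the derivative in the fixed
  direction $(0, 1)$, restricted to the slice $t = 0$; both operations preserve smoothness.\<close>

lemma smooth_at_partial_deriv: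
  assumes M: "smooth_manifold M" and g: "smooth_at (prod_mfd M real_mfd) real_mfd (p, 0) g"
  shows "smooth_at M real_mfd p (\<lambda>q. deriv (\<lambda>t. g (q, t)) 0)"
proof -
  note R = smooth_manifold_real and MR = smooth_manifold_prod[OF M smooth_manifold_real]
  obtain S where S: "(p, 0) \<in> S" "smooth_map_on (prod_mfd M real_mfd) real_mfd S g"
    using g by (auto simp: smooth_at_def)
  have z: "(0::real) \<in> topspace (topo real_mfd)" by (simp add: real_mfd_def)
  have "smooth_map M (prod_mfd M real_mfd) (\<lambda>q. (q, 0))"
    by (intro smooth_map_on_Pair M R smooth_map_on_id smooth_map_on_const z)
  moreover have "openin (topo (prod_mfd M real_mfd)) S" using S(2) by (simp add: smooth_map_on_def)
  ultimately have T: "openin (topo M) {q \<in> topspace (topo M). (q, 0) \<in> S}" (is "openin _ ?T")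
    by (rule smooth_map_on_preimage_open)
  have p: "p \<in> ?T" using S(1) smooth_at_maps(1)[OF g] by simp
  have "smooth_map_on M real_mfd ?T (\<lambda>q. deriv (\<lambda>t. g (q, t)) 0)"
  proof (rule smooth_map_on_realI[OF M T])
    fix U x assume ch: "(U, x) \<in> atlas M"
    let ?q = "map_prod x (id :: real \<Rightarrow> real)" and ?Q = "U \<times> (UNIV :: real set)"
    let ?G = "g \<circ> inv_into ?Q ?q"
    have ch': "(?Q, ?q) \<in> atlas (prod_mfd M real_mfd)"
      using ch by (auto simp: atlas_prod_mfd real_mfd_def)
    have chr: "(UNIV, id) \<in> atlas real_mfd" by (simp add: real_mfd_def)
    let ?W = "?q ` {r \<in> ?Q \<inter> S. g r \<in> UNIV}"
    have W: "open ?W" by (rule chart_preimage_open[OF S(2) MR R ch' chr])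
    have "id \<circ> g \<circ> inv_into ?Q ?q = ?G" by simp
    then have G: "smooth_on ?W ?G" using smooth_map_on_chart[OF S(2) ch' chr] by (simp only:)
    have o: "open (x ` (U \<inter> ?T))"
      by (intro chart_image_open[OF M ch] openin_Int T smooth_manifold_chart(1)[OF M ch] Int_lower1)
    have inW: "(z, 0) \<in> ?W" if z: "z \<in> x ` (U \<inter> ?T)" for z
    proof -
      obtain q where "q \<in> U" "(q, 0) \<in> S" "z = x q" using z by auto
      then show ?thesis by (intro image_eqI[of _ _ "(q, 0)"]) auto
    qed
    \<comment> \<open>The partial derivative of \<open>?G\<close> in the real variable.\<close>
    let ?D = "\<lambda>w. frechet_derivative ?G (at w) (0, 1)"
    have "smooth_on (x ` (U \<inter> ?T)) (\<lambda>z. ?D (z, 0))"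
    proof (rule smooth_on_compose[where g = "\<lambda>z. (z, 0)" and f = ?D, OF _ o W])
      show "\<exists>B::('b \<times> real) set. finite B \<and> span B = UNIV"
        by (rule smooth_manifold_finite_dim[OF MR])
      show "(\<lambda>z. (z, 0)) ` x ` (U \<inter> ?T) \<subseteq> ?W" using inW by blast
      show "smooth_on (x ` (U \<inter> ?T)) (\<lambda>z. (z, 0::real))"
        by (intro smooth_on_Pair o smooth_on_const smooth_on_bounded_linear bounded_linear_ident)
      show "smooth_on ?W ?D" by (rule smooth_on_frechet_derivative[OF G])
    qed
    moreover have "?D (z, 0) = ((\<lambda>q. deriv (\<lambda>t. g (q, t)) 0) \<circ> inv_into U x) z"
      if z: "z \<in> x ` (U \<inter> ?T)" for z
    proof -
      have "inv_into ?Q ?q (z, t) = (inv_into U x z, t)" for t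
        using inv_into_map_prod[OF chart_inj_on[OF M ch] inj_on_id, of z t UNIV] z by auto
      then have "deriv (\<lambda>t. g (inv_into U x z, t)) 0 = deriv (\<lambda>t. ?G ((z, 0) + t *\<^sub>R (0, 1))) 0"
        by simp
      also have "\<dots> = ?D (z, 0)"
        using smooth_on_has_derivative[OF G inW[OF z]]
        by (intro deriv_along_line) (unfold differentiable_def, blast)
      finally show ?thesis by simp
    qed
    ultimately show "smooth_on (x ` (U \<inter> ?T)) ((\<lambda>q. deriv (\<lambda>t. g (q, t)) 0) \<circ> inv_into U x)"
      using smooth_on_cong[OF o, of "\<lambda>z. ?D (z, 0)"] by blast
  qed
  then show ?thesis using p by (rule smooth_atI)
qed

section \<open>Mixed derivatives\<close>

definition mixed_deriv :: "(real \<Rightarrow> real \<Rightarrow> real) \<Rightarrow> real" where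
  "mixed_deriv g = deriv (\<lambda>s. deriv (\<lambda>t. g s t) 0) 0"

lemma mixed_deriv_cong:
  assumes "\<forall>\<^sub>F s in nhds 0. \<forall>\<^sub>F t in nhds 0. g s t = h s t"
  shows "mixed_deriv g = mixed_deriv h"
  unfolding mixed_deriv_def
  by (rule deriv_cong_ev[OF _ refl], rule eventually_mono[OF assms])
    (rule deriv_cong_ev[OF _ refl], simp)

text \<open>The function $k(a, b) = \partial_t K(a, b, 0)$ is differentiable because $K$ is of class $C^2$;
  its derivative at $0$ is linear, and the three mixed derivatives are its values at $(1, 1)$,
  $(1, 0)$ and $(0, 1)$.\<close>

lemma mixed_deriv_diagonal:
  fixes K :: "real \<times> real \<times> real \<Rightarrow> real"
  assumes W: "open W" "(0, 0, 0) \<in> W" and K: "smooth_on W K"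
  shows "mixed_deriv (\<lambda>s t. K (s, s, t)) =
    mixed_deriv (\<lambda>s t. K (s, 0, t)) + mixed_deriv (\<lambda>s t. K (0, s, t))"
proof -
  let ?k = "\<lambda>p. frechet_derivative K (at p) (0, 0, 1)"
  have k: "?k differentiable (at (0, 0, 0))"
    using smooth_on_has_derivative[OF smooth_on_frechet_derivative[OF K] W(2)]
    unfolding differentiable_def by blast
  have line: "mixed_deriv (\<lambda>s t. K (s * a, s * b, t)) = frechet_derivative ?k (at (0, 0, 0)) (a, b, 0)"
    for a b
  proof -
    have "((\<lambda>s. (s * a, s * b, 0)) \<longlongrightarrow> (0 * a, 0 * b, 0)) (nhds (0::real))"
      by (intro tendsto_intros filterlim_ident)
    then have "\<forall>\<^sub>F s in nhds 0. (s * a, s * b, 0) \<in> W"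
      using topological_tendstoD[OF _ W(1)] W(2) by fastforce
    then have "\<forall>\<^sub>F s in nhds 0. deriv (\<lambda>t. K (s * a, s * b, t)) 0 = ?k ((0, 0, 0) + s *\<^sub>R (a, b, 0))"
    proof (rule eventually_mono)
      fix s assume "(s * a, s * b, 0) \<in> W"
      then have "K differentiable (at (s * a, s * b, 0))"
        using smooth_on_has_derivative[OF K] unfolding differentiable_def by blast
      from deriv_along_line[OF this, of "(0, 0, 1)"]
      show "deriv (\<lambda>t. K (s * a, s * b, t)) 0 = ?k ((0, 0, 0) + s *\<^sub>R (a, b, 0))"
        by simp
    qed
    then have "mixed_deriv (\<lambda>s t. K (s * a, s * b, t)) = deriv (\<lambda>s. ?k ((0, 0, 0) + s *\<^sub>R (a, b, 0))) 0"
      unfolding mixed_deriv_def by (rule deriv_cong_ev) (rule refl)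
    also have "\<dots> = frechet_derivative ?k (at (0, 0, 0)) (a, b, 0)"
      by (rule deriv_along_line[OF k])
    finally show ?thesis .
  qed
  have "linear (frechet_derivative ?k (at (0, 0, 0)))"
    using k frechet_derivative_works has_derivative_linear by blast
  from linear_add[OF this, of "(1, 0, 0)" "(0, 1, 0)"]
  have "frechet_derivative ?k (at (0, 0, 0)) (1, 1, 0) =
    frechet_derivative ?k (at (0, 0, 0)) (1, 0, 0) + frechet_derivative ?k (at (0, 0, 0)) (0, 1, 0)"
    by simp
  then show ?thesis
    unfolding line[symmetric] by simp
qed

text \<open>On $\mathbb{R}^3$, regarded as an iterated product manifold, the only chart is the identity, so
  smoothness at a point is smoothness in the sense of calculus.\<close>

lemma smooth_at_real3:
  assumes "smooth_at (prod_mfd real_mfd (prod_mfd real_mfd real_mfd)) real_mfd p K"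
  obtains W where "open W" "p \<in> W" "smooth_on W K"
proof -
  let ?M = "prod_mfd real_mfd (prod_mfd real_mfd real_mfd)"
  obtain S where S: "p \<in> S" "smooth_map_on ?M real_mfd S K"
    using assms by (auto simp: smooth_at_def)
  have "(UNIV \<times> UNIV \<times> UNIV, map_prod id (map_prod id id)) \<in> atlas ?M"
    by (simp add: prod_mfd_def real_mfd_def)
  then have ch: "(UNIV, id) \<in> atlas ?M" by (simp add: prod.map_id0)
  have chr: "(UNIV, id) \<in> atlas real_mfd" by (simp add: real_mfd_def)
  have "smooth_on (id ` {q \<in> UNIV \<inter> S. K q \<in> UNIV}) (id \<circ> K \<circ> inv_into UNIV id)"
    by (rule smooth_map_on_chart[OF S(2) ch chr])
  then have "smooth_on S K" by simp
  moreover have "open S"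
    using S(2) by (simp add: smooth_map_on_def real_mfd_def)
  ultimately show ?thesis using that S(1) by blast
qed

section \<open>Velocities of curves and the tangent map\<close>

lemma velocity_apply:
  "f \<in> smooth_near M (\<gamma> 0) \<Longrightarrow> velocity M \<gamma> f = deriv (\<lambda>t. f (\<gamma> t)) 0"
  by (simp add: velocity_def o_def)

text \<open>A velocity depends only on the germ of the curve. Identities in a group hold only for elements
  of its carrier, so for a curve they hold only near time 0.\<close>

lemma velocity_cong:
  assumes "\<forall>\<^sub>F t in nhds 0. \<gamma> t = \<delta> t"
  shows "velocity M \<gamma> = velocity M \<delta>"
proof -
  have "deriv (f \<circ> \<gamma>) 0 = deriv (f \<circ> \<delta>) 0" for f :: "'a \<Rightarrow> real"
    by (rule deriv_cong_ev[OF eventually_mono[OF assms]]) auto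
  then show ?thesis
    using eventually_nhds_x_imp_x[OF assms] by (simp add: velocity_def fun_eq_iff)
qed

lemma tangent_spaceE:
  assumes "X \<in> tangent_space M p"
  obtains \<gamma> where "X = velocity M \<gamma>" "smooth_at real_mfd M 0 \<gamma>" "\<gamma> 0 = p"
proof -
  obtain \<gamma> \<epsilon> where "X = velocity M \<gamma>" "\<epsilon> > 0" "smooth_map_on real_mfd M {-\<epsilon><..<\<epsilon>} \<gamma>" "\<gamma> 0 = p"
    using assms unfolding tangent_space_def by blast
  moreover from this have "smooth_at real_mfd M 0 \<gamma>"
    by (intro smooth_atI[of _ _ "{-\<epsilon><..<\<epsilon>}"]) simp_all
  ultimately show ?thesis using that by blast
qed

lemma tangent_spaceI:
  assumes "smooth_at real_mfd M 0 \<gamma>" "\<gamma> 0 = p"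
  shows "velocity M \<gamma> \<in> tangent_space M p"
proof -
  obtain S where S: "0 \<in> S" "smooth_map_on real_mfd M S \<gamma>"
    using assms(1) by (auto simp: smooth_at_def)
  then have "open S" by (simp add: smooth_map_on_def real_mfd_def)
  then obtain \<epsilon> where "\<epsilon> > 0" "ball 0 \<epsilon> \<subseteq> S" using S(1) open_contains_ball by blast
  moreover have "ball 0 \<epsilon> = {-\<epsilon><..<\<epsilon>}" by (simp add: ball_eq_greaterThanLessThan)
  ultimately have "smooth_map_on real_mfd M {-\<epsilon><..<\<epsilon>} \<gamma>"
    by (intro smooth_map_on_subset[OF S(2)]) (auto simp: real_mfd_def)
  then show ?thesis using \<open>\<epsilon> > 0\<close> assms(2) unfolding tangent_space_def by blast
qed

lemma smooth_at_map:
  assumes "smooth_map N P F" "smooth_at M N p a"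
    and "smooth_manifold M" "smooth_manifold N" "smooth_manifold P"
  shows "smooth_at M P p (\<lambda>q. F (a q))"
  by (rule smooth_at_compose[OF assms(2) smooth_atI[OF assms(1) smooth_at_maps(2)[OF assms(2)]] assms(3-5)])

lemma tangent_map_velocity:
  assumes "smooth_at M N p F" "\<gamma> 0 = p" "smooth_manifold M" "smooth_manifold N"
  shows "tangent_map M N F p (velocity M \<gamma>) = velocity N (\<lambda>t. F (\<gamma> t))"
proof
  fix f
  have "f \<circ> F \<in> smooth_near M p" if "f \<in> smooth_near N (F p)"
    using smooth_at_compose[OF assms(1) _ assms(3,4) smooth_manifold_real] that
    by (simp add: smooth_near_iff o_def)
  then show "tangent_map M N F p (velocity M \<gamma>) f = velocity N (\<lambda>t. F (\<gamma> t)) f"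
    using assms(2) by (simp add: tangent_map_def velocity_def o_def)
qed

lemma smooth_near_open:
  assumes "f \<in> smooth_near M p"
  obtains S where "openin (topo M) S" "p \<in> S" "\<And>q. q \<in> S \<Longrightarrow> f \<in> smooth_near M q"
  using assms that unfolding smooth_near_def smooth_map_on_def by blast

text \<open>The common core of the formulas for the bracket and for the differentiated action: applying the
  tangent vector of \<open>\<alpha>\<close> to a function that is itself a derivative along
  \<open>\<beta>\<close>. The function \<open>w\<close> is prescribed only near
  \<open>p\<close>, because left-invariant vector fields and tangent actions are given by curves
  only at points of the carrier.\<close>

lemma velocity_deriv_along_curve:
  assumes man: "smooth_manifold M" "smooth_manifold N" "smooth_manifold P"
    and K: "smooth_at (prod_mfd M N) P (p, q) K"
    and \<alpha>: "smooth_at real_mfd M 0 \<alpha>" "\<alpha> 0 = p"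
    and \<beta>: "smooth_at real_mfd N 0 \<beta>" "\<beta> 0 = q"
    and f: "f \<in> smooth_near P (K (p, q))"
    and V: "openin (topo M) V" "p \<in> V"
    and w: "\<And>a. a \<in> V \<Longrightarrow> w a = deriv (\<lambda>t. f (K (a, \<beta> t))) 0"
  shows "velocity M \<alpha> w = mixed_deriv (\<lambda>s t. f (K (\<alpha> s, \<beta> t)))"
proof -
  note R = smooth_manifold_real and MR = smooth_manifold_prod[OF man(1) smooth_manifold_real]
  have p: "(p, 0::real) \<in> topspace (topo (prod_mfd M real_mfd))"
    using smooth_at_maps[OF \<alpha>(1)] \<alpha>(2) by (simp add: real_mfd_def)
  have "smooth_at (prod_mfd M real_mfd) (prod_mfd M N) (p, 0) (\<lambda>z. (fst z, \<beta> (snd z)))"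
  proof (intro smooth_at_Pair MR man smooth_at_fst[where F = "\<lambda>z. z", OF smooth_at_id] R p)
    have "smooth_at (prod_mfd M real_mfd) real_mfd (p, 0) (\<lambda>z. snd z)"
      by (intro smooth_at_snd[where F = "\<lambda>z. z", OF smooth_at_id] MR man R p)
    then show "smooth_at (prod_mfd M real_mfd) N (p, 0) (\<lambda>z. \<beta> (snd z))"
      by (rule smooth_at_compose) (simp_all add: \<beta> MR man R)
  qed
  then have "smooth_at (prod_mfd M real_mfd) P (p, 0) (\<lambda>z. K (fst z, \<beta> (snd z)))"
    by (rule smooth_at_compose) (simp_all add: K \<beta> MR man smooth_manifold_prod)
  then have "smooth_at (prod_mfd M real_mfd) real_mfd (p, 0) (\<lambda>z. f (K (fst z, \<beta> (snd z))))"
    by (rule smooth_at_compose) (use f in \<open>simp_all add: \<beta> MR man R smooth_near_iff\<close>)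
  from smooth_at_partial_deriv[OF man(1) this]
  have "smooth_at M real_mfd p (\<lambda>a. deriv (\<lambda>t. f (K (a, \<beta> t))) 0)" by simp
  \<comment> \<open>Without this, \<open>velocity M \<alpha> w\<close> would take the default value 0.\<close>
  then have "smooth_at M real_mfd p w"
    by (rule smooth_at_cong[OF _ man(1) R V]) (simp add: w)
  then have "velocity M \<alpha> w = deriv (\<lambda>s. w (\<alpha> s)) 0"
    using \<alpha>(2) by (intro velocity_apply) (simp add: smooth_near_iff)
  also have "\<dots> = mixed_deriv (\<lambda>s t. f (K (\<alpha> s, \<beta> t)))"
    unfolding mixed_deriv_def
  proof (rule deriv_cong_ev[OF _ refl])
    have "\<forall>\<^sub>F s in nhds 0. \<alpha> s \<in> V"
      using smooth_at_eventually[OF \<alpha>(1) V(1)] V(2) \<alpha>(2) by simp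
    then show "\<forall>\<^sub>F s in nhds 0. w (\<alpha> s) = deriv (\<lambda>t. f (K (\<alpha> s, \<beta> t))) 0"
      by (rule eventually_mono) (rule w)
  qed
  finally show ?thesis .
qed

section \<open>The bracket and the differentiated action along curves\<close>

lemma lie_groupD:
  assumes "lie_group G"
  shows "group G" "smooth_manifold (lmfd G)" "topspace (topo (lmfd G)) = carrier G"
    "smooth_map (prod_mfd (lmfd G) (lmfd G)) (lmfd G) (\<lambda>(a, b). a \<otimes>\<^bsub>G\<^esub> b)"
    "\<one>\<^bsub>G\<^esub> \<in> carrier G"
  using assms unfolding lie_group_def by (auto intro: monoid.one_closed group.is_monoid)

lemma smooth_at_mult:
  assumes G: "lie_group G" and M: "smooth_manifold M"
    and "smooth_at M (lmfd G) p a" "smooth_at M (lmfd G) p b"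
  shows "smooth_at M (lmfd G) p (\<lambda>q. a q \<otimes>\<^bsub>G\<^esub> b q)"
  using smooth_at_map[OF lie_groupD(4)[OF G] smooth_at_Pair[OF assms(3,4)]]
  by (simp add: M lie_groupD(2)[OF G] smooth_manifold_prod)

lemma eventually_carrier:
  assumes "lie_group G" "smooth_at real_mfd (lmfd G) t \<gamma>"
  shows "\<forall>\<^sub>F s in nhds t. \<gamma> s \<in> carrier G"
  using smooth_at_eventually[OF assms(2), of "carrier G"] smooth_at_maps(2)[OF assms(2)]
    lie_groupD(3)[OF assms(1)] by (metis openin_topspace)

lemma left_invariant_vf_velocity:
  assumes G: "lie_group G" and \<beta>: "smooth_at real_mfd (lmfd G) 0 \<beta>" "\<beta> 0 = \<one>\<^bsub>G\<^esub>"
    and q: "q \<in> carrier G"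
  shows "left_invariant_vf G (velocity (lmfd G) \<beta>) q = velocity (lmfd G) (\<lambda>t. q \<otimes>\<^bsub>G\<^esub> \<beta> t)"
  unfolding left_invariant_vf_def
proof (rule tangent_map_velocity)
  show "smooth_at (lmfd G) (lmfd G) \<one>\<^bsub>G\<^esub> ((\<otimes>\<^bsub>G\<^esub>) q)"
    by (intro smooth_at_mult[OF G, where a = "\<lambda>_. q" and b = "\<lambda>a. a"] smooth_at_const smooth_at_id)
      (simp_all add: lie_groupD[OF G] q)
qed (simp_all add: \<beta> lie_groupD[OF G])

lemma lbracket_velocity:
  assumes G: "lie_group G"
    and \<alpha>: "smooth_at real_mfd (lmfd G) 0 \<alpha>" "\<alpha> 0 = \<one>\<^bsub>G\<^esub>"
    and \<beta>: "smooth_at real_mfd (lmfd G) 0 \<beta>" "\<beta> 0 = \<one>\<^bsub>G\<^esub>"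
  shows "lbracket (lie_algebra_of G) (velocity (lmfd G) \<alpha>) (velocity (lmfd G) \<beta>) =
    (\<lambda>f. if f \<in> smooth_near (lmfd G) \<one>\<^bsub>G\<^esub>
      then mixed_deriv (\<lambda>s t. f (\<alpha> s \<otimes>\<^bsub>G\<^esub> \<beta> t)) - mixed_deriv (\<lambda>s t. f (\<beta> s \<otimes>\<^bsub>G\<^esub> \<alpha> t))
      else 0)"
proof -
  interpret group G by (rule lie_groupD(1)[OF G])
  have one: "left_invariant_vf G (velocity (lmfd G) \<gamma>) \<one>\<^bsub>G\<^esub> (\<lambda>q. left_invariant_vf G (velocity (lmfd G) \<delta>) q f) =
      mixed_deriv (\<lambda>s t. f (\<gamma> s \<otimes>\<^bsub>G\<^esub> \<delta> t))"
    if \<gamma>: "smooth_at real_mfd (lmfd G) 0 \<gamma>" "\<gamma> 0 = \<one>\<^bsub>G\<^esub>"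
      and \<delta>: "smooth_at real_mfd (lmfd G) 0 \<delta>" "\<delta> 0 = \<one>\<^bsub>G\<^esub>"
      and f: "f \<in> smooth_near (lmfd G) \<one>\<^bsub>G\<^esub>" for \<gamma> \<delta> f
  proof -
    have "left_invariant_vf G (velocity (lmfd G) \<gamma>) \<one>\<^bsub>G\<^esub> = velocity (lmfd G) (\<lambda>t. \<one>\<^bsub>G\<^esub> \<otimes>\<^bsub>G\<^esub> \<gamma> t)"
      by (rule left_invariant_vf_velocity[OF G \<gamma> one_closed])
    also have "\<dots> = velocity (lmfd G) \<gamma>"
      by (rule velocity_cong, rule eventually_mono[OF eventually_carrier[OF G \<gamma>(1)]]) simp
    finally have *: "left_invariant_vf G (velocity (lmfd G) \<gamma>) \<one>\<^bsub>G\<^esub> = velocity (lmfd G) \<gamma>" .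
    obtain S where S: "openin (topo (lmfd G)) S" "\<one>\<^bsub>G\<^esub> \<in> S" "\<And>q. q \<in> S \<Longrightarrow> f \<in> smooth_near (lmfd G) q"
      using smooth_near_open[OF f] by blast
    have "velocity (lmfd G) \<gamma> (\<lambda>q. left_invariant_vf G (velocity (lmfd G) \<delta>) q f) =
      mixed_deriv (\<lambda>s t. f ((\<lambda>(a, b). a \<otimes>\<^bsub>G\<^esub> b) (\<gamma> s, \<delta> t)))"
    proof (rule velocity_deriv_along_curve[where K = "\<lambda>(a, b). a \<otimes>\<^bsub>G\<^esub> b" and f = f, OF _ _ _ _ \<gamma> \<delta> _ S(1,2)])
      show "smooth_at (prod_mfd (lmfd G) (lmfd G)) (lmfd G) (\<one>\<^bsub>G\<^esub>, \<one>\<^bsub>G\<^esub>) (\<lambda>(a, b). a \<otimes>\<^bsub>G\<^esub> b)"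
        by (rule smooth_atI[OF lie_groupD(4)[OF G]]) (simp add: lie_groupD(3)[OF G])
      show "f \<in> smooth_near (lmfd G) ((\<lambda>(a, b). a \<otimes>\<^bsub>G\<^esub> b) (\<one>\<^bsub>G\<^esub>, \<one>\<^bsub>G\<^esub>))"
        using f by simp
      fix a assume a: "a \<in> S"
      then have "a \<in> carrier G"
        using openin_subset[OF S(1)] lie_groupD(3)[OF G] by blast
      then show "left_invariant_vf G (velocity (lmfd G) \<delta>) a f =
          deriv (\<lambda>t. f ((\<lambda>(a, b). a \<otimes>\<^bsub>G\<^esub> b) (a, \<delta> t))) 0"
        using S(3)[OF a] by (simp add: left_invariant_vf_velocity[OF G \<delta>] velocity_apply \<delta>(2))
    qed (rule lie_groupD(2)[OF G])+
    then show ?thesis unfolding * by simp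
  qed
  show ?thesis
    by (rule ext) (simp add: lie_algebra_of_def vf_bracket_def one \<alpha> \<beta>)
qed

lemma lie_actionD:
  assumes "lie_action G H \<Phi>"
  shows "g \<in> carrier G \<Longrightarrow> \<Phi> g \<in> hom H H"
    "g \<in> carrier G \<Longrightarrow> smooth_map (lmfd H) (lmfd H) (\<Phi> g)"
    "g \<in> carrier G \<Longrightarrow> bij_betw (\<Phi> g) (carrier H) (carrier H)"
    "g1 \<in> carrier G \<Longrightarrow> g2 \<in> carrier G \<Longrightarrow> h \<in> carrier H \<Longrightarrow> \<Phi> (g1 \<otimes>\<^bsub>G\<^esub> g2) h = \<Phi> g1 (\<Phi> g2 h)"
    "smooth_map (prod_mfd (lmfd G) (lmfd H)) (lmfd H) (\<lambda>(g, h). \<Phi> g h)"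
  using assms unfolding lie_action_def lie_group_aut_def lie_group_hom_def by blast+

lemma lie_action_closed:
  "lie_action G H \<Phi> \<Longrightarrow> g \<in> carrier G \<Longrightarrow> h \<in> carrier H \<Longrightarrow> \<Phi> g h \<in> carrier H"
  using lie_actionD(1)[of G H \<Phi> g] by (auto simp: hom_def)

lemma lie_action_fixes_one:
  assumes "lie_group H" "lie_action G H \<Phi>" "g \<in> carrier G"
  shows "\<Phi> g \<one>\<^bsub>H\<^esub> = \<one>\<^bsub>H\<^esub>"
  by (rule hom_one[OF lie_actionD(1)[OF assms(2,3)] lie_groupD(1)[OF assms(1)] lie_groupD(1)[OF assms(1)]])

text \<open>\<open>\<Phi> \<one>\<close> is idempotent by multiplicativity, and it is injective.\<close>

lemma lie_action_one:
  assumes "lie_group G" "lie_action G H \<Phi>" "h \<in> carrier H"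
  shows "\<Phi> \<one>\<^bsub>G\<^esub> h = h"
proof -
  interpret group G by (rule lie_groupD(1)[OF assms(1)])
  have "\<Phi> \<one>\<^bsub>G\<^esub> (\<Phi> \<one>\<^bsub>G\<^esub> h) = \<Phi> \<one>\<^bsub>G\<^esub> h"
    using lie_actionD(4)[OF assms(2) one_closed one_closed assms(3)] by simp
  then show ?thesis
    using lie_actionD(3)[OF assms(2) one_closed] lie_action_closed[OF assms(2) one_closed assms(3)]
      assms(3) by (auto simp: bij_betw_def dest: inj_onD)
qed

lemma smooth_at_action:
  assumes G: "lie_group G" and H: "lie_group H" and \<Phi>: "lie_action G H \<Phi>" and M: "smooth_manifold M"
    and "smooth_at M (lmfd G) p a" "smooth_at M (lmfd H) p b"
  shows "smooth_at M (lmfd H) p (\<lambda>q. \<Phi> (a q) (b q))"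
  using smooth_at_map[OF lie_actionD(5)[OF \<Phi>] smooth_at_Pair[OF assms(5,6)]]
  by (simp add: M lie_groupD(2)[OF G] lie_groupD(2)[OF H] smooth_manifold_prod)

text \<open>Automorphisms fix the identity of \<open>H\<close>, so at every point of \<open>G\<close> the
  tangent action is evaluated on functions that are smooth near that identity. For other
  \<open>f\<close> it vanishes on all of \<open>G\<close>, as does then its derivative.\<close>

lemma diff_action_velocity:
  assumes G: "lie_group G" and H: "lie_group H" and \<Phi>: "lie_action G H \<Phi>"
    and \<alpha>: "smooth_at real_mfd (lmfd G) 0 \<alpha>" "\<alpha> 0 = \<one>\<^bsub>G\<^esub>"
    and \<beta>: "smooth_at real_mfd (lmfd H) 0 \<beta>" "\<beta> 0 = \<one>\<^bsub>H\<^esub>"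
  shows "diff_action H \<Phi> (velocity (lmfd G) \<alpha>) (velocity (lmfd H) \<beta>) =
    (\<lambda>f. if f \<in> smooth_near (lmfd H) \<one>\<^bsub>H\<^esub> then mixed_deriv (\<lambda>s t. f (\<Phi> (\<alpha> s) (\<beta> t))) else 0)"
proof
  fix f
  let ?w = "\<lambda>g. tangent_action H \<Phi> g (velocity (lmfd H) \<beta>) f"
  have w: "?w g = velocity (lmfd H) (\<lambda>t. \<Phi> g (\<beta> t)) f" if g: "g \<in> carrier G" for g
    unfolding tangent_action_def
    by (subst tangent_map_velocity)
      (use \<beta> lie_groupD[OF H] in \<open>auto intro!: smooth_atI[OF lie_actionD(2)[OF \<Phi> g]]\<close>)
  have carrier: "openin (topo (lmfd G)) (carrier G)"
    using lie_groupD(3)[OF G] openin_topspace by metis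
  have \<Phi>1: "\<Phi> g \<one>\<^bsub>H\<^esub> = \<one>\<^bsub>H\<^esub>" if "g \<in> carrier G" for g
    by (rule lie_action_fixes_one[OF H \<Phi> that])
  show "diff_action H \<Phi> (velocity (lmfd G) \<alpha>) (velocity (lmfd H) \<beta>) f =
    (if f \<in> smooth_near (lmfd H) \<one>\<^bsub>H\<^esub> then mixed_deriv (\<lambda>s t. f (\<Phi> (\<alpha> s) (\<beta> t))) else 0)"
  proof (cases "f \<in> smooth_near (lmfd H) \<one>\<^bsub>H\<^esub>")
    case True
    have "velocity (lmfd G) \<alpha> ?w = mixed_deriv (\<lambda>s t. f ((\<lambda>(g, h). \<Phi> g h) (\<alpha> s, \<beta> t)))"
    proof (rule velocity_deriv_along_curve[where K = "\<lambda>(g, h). \<Phi> g h" and f = f, OF _ _ _ _ \<alpha> \<beta> _ carrier])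
      show "smooth_at (prod_mfd (lmfd G) (lmfd H)) (lmfd H) (\<one>\<^bsub>G\<^esub>, \<one>\<^bsub>H\<^esub>) (\<lambda>(g, h). \<Phi> g h)"
        by (rule smooth_atI[OF lie_actionD(5)[OF \<Phi>]])
          (simp add: lie_groupD[OF G] lie_groupD[OF H])
      show "f \<in> smooth_near (lmfd H) ((\<lambda>(g, h). \<Phi> g h) (\<one>\<^bsub>G\<^esub>, \<one>\<^bsub>H\<^esub>))"
        using True \<Phi>1 lie_groupD(5)[OF G] by simp
      show "?w g = deriv (\<lambda>t. f ((\<lambda>(g, h). \<Phi> g h) (g, \<beta> t))) 0" if g: "g \<in> carrier G" for g
        using True by (simp add: w[OF g] velocity_apply \<beta>(2) \<Phi>1[OF g])
    qed (simp_all add: lie_groupD[OF G] lie_groupD[OF H])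
    then show ?thesis using True by (simp add: diff_action_def)
  next
    case False
    then have "?w g = 0" if "g \<in> carrier G" for g
      using \<Phi>1[OF that] \<beta>(2) unfolding w[OF that] by (simp add: velocity_def)
    then have "\<forall>\<^sub>F s in nhds 0. (?w \<circ> \<alpha>) s = 0"
      using eventually_mono[OF eventually_carrier[OF G \<alpha>(1)]] by simp
    then have "deriv (?w \<circ> \<alpha>) 0 = deriv (\<lambda>_. 0) 0"
      by (rule deriv_cong_ev) (rule refl)
    then show ?thesis using False by (simp add: diff_action_def velocity_def)
  qed
qed

section \<open>Differentiating homomorphisms\<close>

text \<open>Linearity is immediate for functionals. What needs smoothness is that velocities of curves are
  sent to velocities of curves.\<close>

lemma lie_alg_linear_tangent_map:
  assumes "lie_group G" "lie_group K" "smooth_map (lmfd G) (lmfd K) F" "F \<one>\<^bsub>G\<^esub> = \<one>\<^bsub>K\<^esub>"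
  shows "lie_alg_linear (lie_algebra_of G) (lie_algebra_of K)
    (tangent_map (lmfd G) (lmfd K) F \<one>\<^bsub>G\<^esub>)"
proof -
  note man = lie_groupD(2)[OF assms(1)] lie_groupD(2)[OF assms(2)]
  have "tangent_map (lmfd G) (lmfd K) F \<one>\<^bsub>G\<^esub> X \<in> tangent_space (lmfd K) \<one>\<^bsub>K\<^esub>"
    if X: "X \<in> tangent_space (lmfd G) \<one>\<^bsub>G\<^esub>" for X
  proof -
    obtain \<gamma> where X: "X = velocity (lmfd G) \<gamma>"
      and \<gamma>: "smooth_at real_mfd (lmfd G) 0 \<gamma>" "\<gamma> 0 = \<one>\<^bsub>G\<^esub>"
      using tangent_spaceE[OF X] by blast
    have "smooth_at (lmfd G) (lmfd K) \<one>\<^bsub>G\<^esub> F"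
      by (rule smooth_atI[OF assms(3)]) (simp add: lie_groupD[OF assms(1)])
    from tangent_map_velocity[where \<gamma> = \<gamma>, OF this \<gamma>(2) man]
    have "tangent_map (lmfd G) (lmfd K) F \<one>\<^bsub>G\<^esub> X = velocity (lmfd K) (\<lambda>t. F (\<gamma> t))"
      by (simp only: X)
    moreover have "velocity (lmfd K) (\<lambda>t. F (\<gamma> t)) \<in> tangent_space (lmfd K) \<one>\<^bsub>K\<^esub>"
      by (rule tangent_spaceI[OF smooth_at_map[OF assms(3) \<gamma>(1) smooth_manifold_real man]])
        (simp add: \<gamma>(2) assms(4))
    ultimately show ?thesis by simp
  qed
  then show ?thesis
    by (auto simp: lie_alg_linear_def lie_algebra_of_def tangent_map_def fun_eq_iff)
qed

lemma tangent_map_one_velocity: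
  assumes "lie_group G" "lie_group K" "smooth_map (lmfd G) (lmfd K) F"
    and \<gamma>: "\<gamma> 0 = \<one>\<^bsub>G\<^esub>"
  shows "tangent_map (lmfd G) (lmfd K) F \<one>\<^bsub>G\<^esub> (velocity (lmfd G) \<gamma>) = velocity (lmfd K) (\<lambda>t. F (\<gamma> t))"
  by (rule tangent_map_velocity[where \<gamma> = \<gamma>, OF smooth_atI[OF assms(3)] \<gamma> lie_groupD(2)[OF assms(1)]
        lie_groupD(2)[OF assms(2)]])
    (simp add: lie_groupD[OF assms(1)])

lemma smooth_near_pullback:
  assumes "lie_group G" "lie_group K" "smooth_map (lmfd G) (lmfd K) F" "F \<one>\<^bsub>G\<^esub> = \<one>\<^bsub>K\<^esub>"
    and f: "f \<in> smooth_near (lmfd K) \<one>\<^bsub>K\<^esub>"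
  shows "f \<circ> F \<in> smooth_near (lmfd G) \<one>\<^bsub>G\<^esub>"
proof -
  have "smooth_at (lmfd G) (lmfd K) \<one>\<^bsub>G\<^esub> F"
    by (rule smooth_atI[OF assms(3)]) (simp add: lie_groupD[OF assms(1)])
  from smooth_at_compose[OF this _ lie_groupD(2)[OF assms(1)] lie_groupD(2)[OF assms(2)]
      smooth_manifold_real, of f] f assms(4)
  show ?thesis by (simp add: smooth_near_iff o_def)
qed

lemma lie_group_homD:
  assumes "\<Psi> \<in> lie_group_hom G K"
  shows "smooth_map (lmfd G) (lmfd K) \<Psi>" "\<Psi> \<in> hom G K"
  using assms by (auto simp: lie_group_hom_def)

lemma lie_group_hom_one:
  assumes "lie_group G" "lie_group K" "\<Psi> \<in> lie_group_hom G K"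
  shows "\<Psi> \<one>\<^bsub>G\<^esub> = \<one>\<^bsub>K\<^esub>"
  by (rule hom_one[OF lie_group_homD(2)[OF assms(3)] lie_groupD(1)[OF assms(1)] lie_groupD(1)[OF assms(2)]])

lemma mixed_deriv_cong_carrier:
  assumes G: "lie_group G" "smooth_at real_mfd (lmfd G) 0 \<alpha>"
    and H: "lie_group H" "smooth_at real_mfd (lmfd H) 0 \<beta>"
    and eq: "\<And>s t. \<alpha> s \<in> carrier G \<Longrightarrow> \<beta> t \<in> carrier H \<Longrightarrow> g s t = h s t"
  shows "mixed_deriv g = mixed_deriv h"
proof (rule mixed_deriv_cong)
  show "\<forall>\<^sub>F s in nhds 0. \<forall>\<^sub>F t in nhds 0. g s t = h s t"
    using eventually_carrier[OF G]
  proof (rule eventually_mono)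
    fix s assume "\<alpha> s \<in> carrier G"
    then show "\<forall>\<^sub>F t in nhds 0. g s t = h s t"
      by (intro eventually_mono[OF eventually_carrier[OF H]] eq)
  qed
qed

lemma lie_alg_hom_tangent_map:
  assumes G: "lie_group G" and K: "lie_group K" and \<Psi>: "\<Psi> \<in> lie_group_hom G K"
  shows "lie_alg_hom (lie_algebra_of G) (lie_algebra_of K)
    (tangent_map (lmfd G) (lmfd K) \<Psi> \<one>\<^bsub>G\<^esub>)"
proof -
  let ?T = "tangent_map (lmfd G) (lmfd K) \<Psi> \<one>\<^bsub>G\<^esub>"
  note sm = lie_group_homD(1)[OF \<Psi>] and one = lie_group_hom_one[OF G K \<Psi>]
  have "?T (lbracket (lie_algebra_of G) X Y) = lbracket (lie_algebra_of K) (?T X) (?T Y)"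
    if XY: "X \<in> tangent_space (lmfd G) \<one>\<^bsub>G\<^esub>" "Y \<in> tangent_space (lmfd G) \<one>\<^bsub>G\<^esub>" for X Y
  proof -
    obtain \<alpha> where X: "X = velocity (lmfd G) \<alpha>"
      and \<alpha>: "smooth_at real_mfd (lmfd G) 0 \<alpha>" "\<alpha> 0 = \<one>\<^bsub>G\<^esub>"
      using tangent_spaceE[OF XY(1)] by blast
    obtain \<beta> where Y: "Y = velocity (lmfd G) \<beta>"
      and \<beta>: "smooth_at real_mfd (lmfd G) 0 \<beta>" "\<beta> 0 = \<one>\<^bsub>G\<^esub>"
      using tangent_spaceE[OF XY(2)] by blast
    have push: "smooth_at real_mfd (lmfd K) 0 (\<lambda>t. \<Psi> (\<gamma> t))" "\<Psi> (\<gamma> 0) = \<one>\<^bsub>K\<^esub>"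
      if "smooth_at real_mfd (lmfd G) 0 \<gamma>" "\<gamma> 0 = \<one>\<^bsub>G\<^esub>" for \<gamma>
      using smooth_at_map[OF sm that(1) smooth_manifold_real lie_groupD(2)[OF G] lie_groupD(2)[OF K]]
        that(2) one by simp_all
    have mult: "mixed_deriv (\<lambda>s t. f (\<Psi> (\<gamma> s \<otimes>\<^bsub>G\<^esub> \<delta> t))) =
        mixed_deriv (\<lambda>s t. f (\<Psi> (\<gamma> s) \<otimes>\<^bsub>K\<^esub> \<Psi> (\<delta> t)))"
      if "smooth_at real_mfd (lmfd G) 0 \<gamma>" "smooth_at real_mfd (lmfd G) 0 \<delta>"
      for f :: "'c \<Rightarrow> real" and \<gamma> \<delta>
      by (rule mixed_deriv_cong_carrier[OF G that(1) G that(2)])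
        (simp add: hom_mult[OF lie_group_homD(2)[OF \<Psi>]])
    show ?thesis
    proof
      fix f
      have "f \<circ> \<Psi> \<in> smooth_near (lmfd G) \<one>\<^bsub>G\<^esub>" if "f \<in> smooth_near (lmfd K) \<one>\<^bsub>K\<^esub>"
        by (rule smooth_near_pullback[OF G K sm one that])
      then show "?T (lbracket (lie_algebra_of G) X Y) f = lbracket (lie_algebra_of K) (?T X) (?T Y) f"
        unfolding X Y tangent_map_one_velocity[where \<gamma> = \<alpha>, OF G K sm \<alpha>(2)] tangent_map_one_velocity[where \<gamma> = \<beta>, OF G K sm \<beta>(2)]
          lbracket_velocity[OF G \<alpha> \<beta>] lbracket_velocity[OF K push[OF \<alpha>] push[OF \<beta>]]
        by (simp add: tangent_map_def one mult \<alpha> \<beta>)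
    qed
  qed
  moreover have "lcarrier (lie_algebra_of G) = tangent_space (lmfd G) \<one>\<^bsub>G\<^esub>"
    by (simp add: lie_algebra_of_def)
  ultimately show ?thesis
    unfolding lie_alg_hom_def using lie_alg_linear_tangent_map[OF G K sm one] by simp
qed

section \<open>Differentiating Rota-Baxter operators\<close>

lemma rb_operatorD:
  assumes "rb_operator G H \<Phi> B"
  shows "smooth_map (lmfd H) (lmfd G) B"
    "h1 \<in> carrier H \<Longrightarrow> h2 \<in> carrier H \<Longrightarrow> B h1 \<otimes>\<^bsub>G\<^esub> B h2 = B (h1 \<otimes>\<^bsub>H\<^esub> \<Phi> (B h1) h2)"
  using assms by (auto simp: rb_operator_def)

lemma rb_operator_closed:
  assumes "lie_group G" "lie_group H" "rb_operator G H \<Phi> B" "h \<in> carrier H"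
  shows "B h \<in> carrier G"
  using smooth_map_on_maps(2)[OF rb_operatorD(1)[OF assms(3)], of h] assms(4)
  by (simp add: lie_groupD(3)[OF assms(1)] lie_groupD(3)[OF assms(2)])

text \<open>The Rota-Baxter identity at the identity says that \<open>B \<one>\<close> is idempotent,
  because $\Phi(B(1))$ fixes the identity of \<open>H\<close>.\<close>

lemma rb_operator_one:
  assumes G: "lie_group G" and H: "lie_group H" and \<Phi>: "lie_action G H \<Phi>"
    and B: "rb_operator G H \<Phi> B"
  shows "B \<one>\<^bsub>H\<^esub> = \<one>\<^bsub>G\<^esub>"
proof -
  interpret G: group G by (rule lie_groupD(1)[OF G])
  interpret H: group H by (rule lie_groupD(1)[OF H])
  have B1: "B \<one>\<^bsub>H\<^esub> \<in> carrier G" by (rule rb_operator_closed[OF G H B]) simp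
  have "B \<one>\<^bsub>H\<^esub> \<otimes>\<^bsub>G\<^esub> B \<one>\<^bsub>H\<^esub> = B \<one>\<^bsub>H\<^esub>"
    using rb_operatorD(2)[OF B H.one_closed H.one_closed] lie_action_fixes_one[OF H \<Phi> B1] by simp
  then show ?thesis using B1 by (simp add: G.l_cancel_one)
qed

text \<open>Half of the infinitesimal Rota-Baxter identity, before antisymmetrization in
  \<open>\<alpha>\<close> and \<open>\<beta>\<close>. The two occurrences of $h_1$ on the right
  of $B(h_1) B(h_2) = B(h_1 \cdot \Phi(B(h_1)) h_2)$ are given independent parameters, and the
  product rule is \<open>mixed_deriv_diagonal\<close>.\<close>

lemma mixed_deriv_rb_operator:
  assumes G: "lie_group G" and H: "lie_group H" and \<Phi>: "lie_action G H \<Phi>"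
    and B: "rb_operator G H \<Phi> B"
    and \<alpha>: "smooth_at real_mfd (lmfd H) 0 \<alpha>" "\<alpha> 0 = \<one>\<^bsub>H\<^esub>"
    and \<beta>: "smooth_at real_mfd (lmfd H) 0 \<beta>" "\<beta> 0 = \<one>\<^bsub>H\<^esub>"
    and f: "f \<in> smooth_near (lmfd G) \<one>\<^bsub>G\<^esub>"
  shows "mixed_deriv (\<lambda>s t. f (B (\<alpha> s) \<otimes>\<^bsub>G\<^esub> B (\<beta> t))) =
    mixed_deriv (\<lambda>s t. f (B (\<alpha> s \<otimes>\<^bsub>H\<^esub> \<beta> t))) + mixed_deriv (\<lambda>s t. f (B (\<Phi> (B (\<alpha> s)) (\<beta> t))))"
proof -
  interpret H: group H by (rule lie_groupD(1)[OF H])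
  note manG = lie_groupD(2)[OF G] and manH = lie_groupD(2)[OF H] and R = smooth_manifold_real
  note R2 = smooth_manifold_prod[OF R R]
  note R3 = smooth_manifold_prod[OF R R2]
  note smB = rb_operatorD(1)[OF B] and B1 = rb_operator_one[OF G H \<Phi> B]
  let ?R3 = "prod_mfd real_mfd (prod_mfd real_mfd real_mfd)"
  \<comment> \<open>On the diagonal \<open>(s, s, t)\<close> this is the right-hand side of the Rota-Baxter identity.\<close>
  define K where "K = (\<lambda>z. f (B (\<alpha> (fst z) \<otimes>\<^bsub>H\<^esub> \<Phi> (B (\<alpha> (fst (snd z)))) (\<beta> (snd (snd z))))))"
  have 0: "(0, 0, 0) \<in> topspace (topo ?R3)" by (simp add: real_mfd_def)
  have z: "smooth_at ?R3 ?R3 (0, 0, 0) (\<lambda>z. z)" by (rule smooth_at_id[OF R3 0])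
  have z1: "smooth_at ?R3 real_mfd (0, 0, 0) (\<lambda>z. fst z)" by (rule smooth_at_fst[OF z R3 R R2])
  have z23: "smooth_at ?R3 (prod_mfd real_mfd real_mfd) (0, 0, 0) (\<lambda>z. snd z)"
    by (rule smooth_at_snd[OF z R3 R R2])
  have z2: "smooth_at ?R3 real_mfd (0, 0, 0) (\<lambda>z. fst (snd z))" by (rule smooth_at_fst[OF z23 R3 R R])
  have z3: "smooth_at ?R3 real_mfd (0, 0, 0) (\<lambda>z. snd (snd z))" by (rule smooth_at_snd[OF z23 R3 R R])
  have "smooth_at ?R3 (lmfd H) (0, 0, 0) (\<lambda>z. \<alpha> (fst z))"
    by (rule smooth_at_compose[OF z1 _ R3 R manH]) (simp add: \<alpha>(1))
  moreover have "smooth_at ?R3 (lmfd H) (0, 0, 0) (\<lambda>z. \<alpha> (fst (snd z)))"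
    by (rule smooth_at_compose[OF z2 _ R3 R manH]) (simp add: \<alpha>(1))
  then have "smooth_at ?R3 (lmfd G) (0, 0, 0) (\<lambda>z. B (\<alpha> (fst (snd z))))"
    by (rule smooth_at_map[OF smB _ R3 manH manG])
  moreover have "smooth_at ?R3 (lmfd H) (0, 0, 0) (\<lambda>z. \<beta> (snd (snd z)))"
    by (rule smooth_at_compose[OF z3 _ R3 R manH]) (simp add: \<beta>(1))
  ultimately have "smooth_at ?R3 (lmfd H) (0, 0, 0)
      (\<lambda>z. \<alpha> (fst z) \<otimes>\<^bsub>H\<^esub> \<Phi> (B (\<alpha> (fst (snd z)))) (\<beta> (snd (snd z))))"
    by (intro smooth_at_mult[OF H R3] smooth_at_action[OF G H \<Phi> R3])
  from smooth_at_map[OF smB this R3 manH manG]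
  have "smooth_at ?R3 real_mfd (0, 0, 0) K"
    unfolding K_def
    by (rule smooth_at_compose[OF _ _ R3 manG R])
      (use f in \<open>simp add: \<alpha>(2) \<beta>(2) B1 lie_action_one[OF G \<Phi>] smooth_near_iff\<close>)
  then obtain W where "open W" "(0, 0, 0) \<in> W" "smooth_on W K"
    by (rule smooth_at_real3)
  from mixed_deriv_diagonal[OF this]
  have "mixed_deriv (\<lambda>s t. K (s, s, t)) =
    mixed_deriv (\<lambda>s t. K (s, 0, t)) + mixed_deriv (\<lambda>s t. K (0, s, t))" .
  moreover have "mixed_deriv (\<lambda>s t. K (s, s, t)) = mixed_deriv (\<lambda>s t. f (B (\<alpha> s) \<otimes>\<^bsub>G\<^esub> B (\<beta> t)))"
    by (rule mixed_deriv_cong_carrier[OF H \<alpha>(1) H \<beta>(1)]) (simp add: K_def rb_operatorD(2)[OF B])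
  moreover have "mixed_deriv (\<lambda>s t. K (s, 0, t)) = mixed_deriv (\<lambda>s t. f (B (\<alpha> s \<otimes>\<^bsub>H\<^esub> \<beta> t)))"
    by (rule mixed_deriv_cong_carrier[OF H \<alpha>(1) H \<beta>(1)])
      (simp add: K_def \<alpha>(2) B1 lie_action_one[OF G \<Phi>])
  moreover have "mixed_deriv (\<lambda>s t. K (0, s, t)) = mixed_deriv (\<lambda>s t. f (B (\<Phi> (B (\<alpha> s)) (\<beta> t))))"
    by (rule mixed_deriv_cong_carrier[OF H \<alpha>(1) H \<beta>(1)])
      (simp add: K_def \<alpha>(2) lie_action_closed[OF \<Phi>] rb_operator_closed[OF G H B])
  ultimately show ?thesis by simp
qed

text \<open>Evaluated at \<open>f\<close>, the right-hand side of the identity is evaluated at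
  \<open>f \<circ> B\<close>, so the claim is the difference of two instances of the previous
  lemma, for \<open>\<alpha>, \<beta>\<close> and for \<open>\<beta>, \<alpha>\<close>.\<close>

lemma alg_rb_operator_tangent_map:
  assumes G: "lie_group G" and H: "lie_group H" and \<Phi>: "lie_action G H \<Phi>"
    and B: "rb_operator G H \<Phi> B"
  shows "alg_rb_operator (lie_algebra_of G) (lie_algebra_of H) (diff_action H \<Phi>)
    (tangent_map (lmfd H) (lmfd G) B \<one>\<^bsub>H\<^esub>)"
proof -
  let ?T = "tangent_map (lmfd H) (lmfd G) B \<one>\<^bsub>H\<^esub>"
  note sm = rb_operatorD(1)[OF B] and one = rb_operator_one[OF G H \<Phi> B]
  have "lbracket (lie_algebra_of G) (?T u) (?T v) =
      ?T (ladd (lie_algebra_of H) (lminus (lie_algebra_of H) (diff_action H \<Phi> (?T u) v)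
        (diff_action H \<Phi> (?T v) u)) (lbracket (lie_algebra_of H) u v))"
    if uv: "u \<in> tangent_space (lmfd H) \<one>\<^bsub>H\<^esub>" "v \<in> tangent_space (lmfd H) \<one>\<^bsub>H\<^esub>" for u v
  proof -
    obtain \<alpha> where u: "u = velocity (lmfd H) \<alpha>"
      and \<alpha>: "smooth_at real_mfd (lmfd H) 0 \<alpha>" "\<alpha> 0 = \<one>\<^bsub>H\<^esub>"
      using tangent_spaceE[OF uv(1)] by blast
    obtain \<beta> where v: "v = velocity (lmfd H) \<beta>"
      and \<beta>: "smooth_at real_mfd (lmfd H) 0 \<beta>" "\<beta> 0 = \<one>\<^bsub>H\<^esub>"
      using tangent_spaceE[OF uv(2)] by blast
    have push: "smooth_at real_mfd (lmfd G) 0 (\<lambda>t. B (\<gamma> t))" "B (\<gamma> 0) = \<one>\<^bsub>G\<^esub>"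
      if "smooth_at real_mfd (lmfd H) 0 \<gamma>" "\<gamma> 0 = \<one>\<^bsub>H\<^esub>" for \<gamma>
      using smooth_at_map[OF sm that(1) smooth_manifold_real lie_groupD(2)[OF H] lie_groupD(2)[OF G]]
        that(2) one by simp_all
    show ?thesis
    proof
      fix f
      have pull: "f \<circ> B \<in> smooth_near (lmfd H) \<one>\<^bsub>H\<^esub>" if "f \<in> smooth_near (lmfd G) \<one>\<^bsub>G\<^esub>"
        by (rule smooth_near_pullback[OF H G sm one that])
      show "lbracket (lie_algebra_of G) (?T u) (?T v) f =
        ?T (ladd (lie_algebra_of H) (lminus (lie_algebra_of H) (diff_action H \<Phi> (?T u) v)
          (diff_action H \<Phi> (?T v) u)) (lbracket (lie_algebra_of H) u v)) f"
        unfolding u v tangent_map_one_velocity[where \<gamma> = \<alpha>, OF H G sm \<alpha>(2)] tangent_map_one_velocity[where \<gamma> = \<beta>, OF H G sm \<beta>(2)]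
          lbracket_velocity[OF H \<alpha> \<beta>] lbracket_velocity[OF G push[OF \<alpha>] push[OF \<beta>]]
          diff_action_velocity[OF G H \<Phi> push[OF \<alpha>] \<beta>] diff_action_velocity[OF G H \<Phi> push[OF \<beta>] \<alpha>]
        using pull mixed_deriv_rb_operator[OF G H \<Phi> B \<alpha> \<beta>, of f]
          mixed_deriv_rb_operator[OF G H \<Phi> B \<beta> \<alpha>, of f]
        by (simp add: tangent_map_def one lie_algebra_of_def)
    qed
  qed
  moreover have "lcarrier (lie_algebra_of H) = tangent_space (lmfd H) \<one>\<^bsub>H\<^esub>"
    by (simp add: lie_algebra_of_def)
  ultimately show ?thesis
    unfolding alg_rb_operator_def using lie_alg_linear_tangent_map[OF H G sm one] by simp
qed

theorem proposition4p2:
  fixes G :: "('g, 'e::real_inner) lie_grp"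
    and H :: "('h, 'f::real_inner) lie_grp"
    and \<Phi> :: "'g \<Rightarrow> 'h \<Rightarrow> 'h"
    and B B' :: "'h \<Rightarrow> 'g"
    and \<Psi>\<^sub>G :: "'g \<Rightarrow> 'g" and \<Psi>\<^sub>H :: "'h \<Rightarrow> 'h"
  assumes "lie_group G" and "lie_group H"
    and "lie_action G H \<Phi>"
    and "rb_operator G H \<Phi> B" and "rb_operator G H \<Phi> B'"
    and "rb_hom G H \<Phi> B' B \<Psi>\<^sub>G \<Psi>\<^sub>H"
  shows "alg_rb_hom (lie_algebra_of G) (lie_algebra_of H) (diff_action H \<Phi>)
           (tangent_map (lmfd H) (lmfd G) B' \<one>\<^bsub>H\<^esub>)
           (tangent_map (lmfd H) (lmfd G) B \<one>\<^bsub>H\<^esub>)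
           (tangent_map (lmfd G) (lmfd G) \<Psi>\<^sub>G \<one>\<^bsub>G\<^esub>)
           (tangent_map (lmfd H) (lmfd H) \<Psi>\<^sub>H \<one>\<^bsub>H\<^esub>)"
proof -
  note G = assms(1) and H = assms(2) and \<Phi> = assms(3) and B = assms(4) and B' = assms(5)
  have \<Psi>G: "\<Psi>\<^sub>G \<in> lie_group_hom G G" and \<Psi>H: "\<Psi>\<^sub>H \<in> lie_group_hom H H"
    and intertwine: "\<And>h. h \<in> carrier H \<Longrightarrow> B (\<Psi>\<^sub>H h) = \<Psi>\<^sub>G (B' h)"
    and equivariant: "\<And>g h. g \<in> carrier G \<Longrightarrow> h \<in> carrier H \<Longrightarrow> \<Psi>\<^sub>H (\<Phi> g h) = \<Phi> (\<Psi>\<^sub>G g) (\<Psi>\<^sub>H h)"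
    using assms(6) by (auto simp: rb_hom_def)
  note smG = lie_group_homD(1)[OF \<Psi>G] and smH = lie_group_homD(1)[OF \<Psi>H]
  note oneG = lie_group_hom_one[OF G G \<Psi>G] and oneH = lie_group_hom_one[OF H H \<Psi>H]
  note manG = lie_groupD(2)[OF G] and manH = lie_groupD(2)[OF H] and R = smooth_manifold_real
  let ?\<psi>G = "tangent_map (lmfd G) (lmfd G) \<Psi>\<^sub>G \<one>\<^bsub>G\<^esub>"
  let ?\<psi>H = "tangent_map (lmfd H) (lmfd H) \<Psi>\<^sub>H \<one>\<^bsub>H\<^esub>"
  have "?\<psi>G (tangent_map (lmfd H) (lmfd G) B' \<one>\<^bsub>H\<^esub> v) = tangent_map (lmfd H) (lmfd G) B \<one>\<^bsub>H\<^esub> (?\<psi>H v)"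
    if v: "v \<in> tangent_space (lmfd H) \<one>\<^bsub>H\<^esub>" for v
  proof -
    obtain \<beta> where \<beta>: "v = velocity (lmfd H) \<beta>" "smooth_at real_mfd (lmfd H) 0 \<beta>" "\<beta> 0 = \<one>\<^bsub>H\<^esub>"
      using tangent_spaceE[OF v] by blast
    have "?\<psi>G (tangent_map (lmfd H) (lmfd G) B' \<one>\<^bsub>H\<^esub> v) = velocity (lmfd G) (\<lambda>t. \<Psi>\<^sub>G (B' (\<beta> t)))"
      by (simp add: \<beta> tangent_map_one_velocity[OF H G rb_operatorD(1)[OF B']]
          tangent_map_one_velocity[OF G G smG] rb_operator_one[OF G H \<Phi> B'])
    also have "\<dots> = velocity (lmfd G) (\<lambda>t. B (\<Psi>\<^sub>H (\<beta> t)))"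
      by (rule velocity_cong, rule eventually_mono[OF eventually_carrier[OF H \<beta>(2)]])
        (simp add: intertwine)
    also have "\<dots> = tangent_map (lmfd H) (lmfd G) B \<one>\<^bsub>H\<^esub> (?\<psi>H v)"
      by (simp add: \<beta> tangent_map_one_velocity[OF H G rb_operatorD(1)[OF B]]
          tangent_map_one_velocity[OF H H smH] oneH)
    finally show ?thesis .
  qed
  moreover have "?\<psi>H (diff_action H \<Phi> x v) = diff_action H \<Phi> (?\<psi>G x) (?\<psi>H v)"
    if x: "x \<in> tangent_space (lmfd G) \<one>\<^bsub>G\<^esub>" and v: "v \<in> tangent_space (lmfd H) \<one>\<^bsub>H\<^esub>" for x v
  proof -
    obtain \<alpha> where x: "x = velocity (lmfd G) \<alpha>"
      and \<alpha>: "smooth_at real_mfd (lmfd G) 0 \<alpha>" "\<alpha> 0 = \<one>\<^bsub>G\<^esub>"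
      using tangent_spaceE[OF x] by blast
    obtain \<beta> where v: "v = velocity (lmfd H) \<beta>"
      and \<beta>: "smooth_at real_mfd (lmfd H) 0 \<beta>" "\<beta> 0 = \<one>\<^bsub>H\<^esub>"
      using tangent_spaceE[OF v] by blast
    have \<Psi>\<alpha>: "smooth_at real_mfd (lmfd G) 0 (\<lambda>t. \<Psi>\<^sub>G (\<alpha> t))" "\<Psi>\<^sub>G (\<alpha> 0) = \<one>\<^bsub>G\<^esub>"
      using smooth_at_map[OF smG \<alpha>(1) R manG manG] \<alpha>(2) oneG by simp_all
    have \<Psi>\<beta>: "smooth_at real_mfd (lmfd H) 0 (\<lambda>t. \<Psi>\<^sub>H (\<beta> t))" "\<Psi>\<^sub>H (\<beta> 0) = \<one>\<^bsub>H\<^esub>"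
      using smooth_at_map[OF smH \<beta>(1) R manH manH] \<beta>(2) oneH by simp_all
    show ?thesis
    proof
      fix f
      have "f \<circ> \<Psi>\<^sub>H \<in> smooth_near (lmfd H) \<one>\<^bsub>H\<^esub>" if "f \<in> smooth_near (lmfd H) \<one>\<^bsub>H\<^esub>"
        by (rule smooth_near_pullback[OF H H smH oneH that])
      moreover have "mixed_deriv (\<lambda>s t. f (\<Psi>\<^sub>H (\<Phi> (\<alpha> s) (\<beta> t)))) =
          mixed_deriv (\<lambda>s t. f (\<Phi> (\<Psi>\<^sub>G (\<alpha> s)) (\<Psi>\<^sub>H (\<beta> t))))"
        by (rule mixed_deriv_cong_carrier[OF G \<alpha>(1) H \<beta>(1)]) (simp add: equivariant)
      ultimately show "?\<psi>H (diff_action H \<Phi> x v) f = diff_action H \<Phi> (?\<psi>G x) (?\<psi>H v) f"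
        unfolding x v tangent_map_one_velocity[where \<gamma> = \<alpha>, OF G G smG \<alpha>(2)] tangent_map_one_velocity[where \<gamma> = \<beta>, OF H H smH \<beta>(2)]
          diff_action_velocity[OF G H \<Phi> \<alpha> \<beta>] diff_action_velocity[OF G H \<Phi> \<Psi>\<alpha> \<Psi>\<beta>]
        by (simp add: tangent_map_def oneH)
    qed
  qed
  moreover have "lcarrier (lie_algebra_of H) = tangent_space (lmfd H) \<one>\<^bsub>H\<^esub>"
    "lcarrier (lie_algebra_of G) = tangent_space (lmfd G) \<one>\<^bsub>G\<^esub>"
    by (simp_all add: lie_algebra_of_def)
  ultimately show ?thesis
    unfolding alg_rb_hom_def
    using alg_rb_operator_tangent_map[OF G H \<Phi> B'] alg_rb_operator_tangent_map[OF G H \<Phi> B]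
      lie_alg_hom_tangent_map[OF G G \<Psi>G] lie_alg_hom_tangent_map[OF H H \<Psi>H]
    by simp
qed

end
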